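(* Let $\lambda$ be a transfinite $\times$-number, let $\mathbb{Q}_\lambda=\{(a,b)\in\mathbb{Q}_\infty: a,b\in\mathbb{Z}_\lambda\}$, and let $\le_\lambda,+_\lambda,-_\lambda,\times_\lambda,\div_\lambda$ be the restrictions of the Surrational order, addition, negation, multiplication and inversion to $\mathbb{Q}_\lambda$, and $\mathcal{Q}_\lambda$ the resulting structure with $0=(0,1)$, $1=(1,1)$. Then: (1) $\mathbb{Q}_\lambda$ is a set; (2) $\le_\lambda$ is a total ordering on $\mathbb{Q}_\lambda$; (3)–(6) $+_\lambda,\times_\lambda:\mathbb{Q}_\lambda\times\mathbb{Q}_\lambda\to\mathbb{Q}_\lambda$ and $-_\lambda,\div_\lambda:\mathbb{Q}_\lambda\to\mathbb{Q}_\lambda$ are functions; (7) $\mathcal{Q}_\lambda$ is an ordered field; (8) the class $\{\mathcal{Q}_\lambda:\lambda\text{ a }\times\text{-number}\}$ is a proper class.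
   Context: $\oplus,\otimes$ denote the natural (Hessenberg) sum and product of ordinals. $\lambda$ is a transfinite $\times$-number if $\omega\le\lambda$ and $\beta\otimes\gamma<\lambda$ for all $\beta,\gamma<\lambda$. $\mathbb{Z}_\infty$ is the class of pairs $(\alpha,\beta)$ of ordinals whose Cantor normal forms share no exponent, identified with finite formal sums $\sum_\zeta\omega^\zeta c_\zeta$, $c_\zeta\in\mathbb{Z}$ (positive coefficients from $\beta$, negated from $\alpha$); $1^{st},2^{nd}$ denote coordinates. Coefficientwise addition, $-(\alpha,\beta)=(\beta,\alpha)$, multiplication $(\sum\omega^\zeta c_\zeta)(\sum\omega^\eta d_\eta)=\sum_\theta\omega^\theta\sum_{\zeta\oplus\eta=\theta}c_\zeta d_\eta$, $0=(0,0)$, $1=(0,1)$. $\mathbb{Z}_\infty^+=\{a:1^{st}a\le2^{nd}a\}$, $\mathbb{Z}_\infty^-=\{a:2^{nd}a<1^{st}a\}$; $a\le b$ iff ($a\in\mathbb{Z}_\infty^-,b\in\mathbb{Z}_\infty^+$) or ($a,b\in\mathbb{Z}_\infty^+$ and [$2^{nd}a<2^{nd}b$ or ($2^{nd}a=2^{nd}b$ and $1^{st}b\le1^{st}a$)]) or ($a,b\in\mathbb{Z}_\infty^-$ and [$1^{st}b<1^{st}a$ or ($1^{st}a=1^{st}b$ and $2^{nd}a\le2^{nd}b$)]). $\mathbb{Z}_\lambda=\{a\in\mathbb{Z}_\infty:1^{st}a<\lambda,2^{nd}a<\lambda\}$. Let $P=\mathbb{Z}_\infty^+\setminus\{0\}$.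 $\mathbb{Q}_\infty$ is the class of pairs $(a,b)\in\mathbb{Z}_\infty\times P$ whose only common divisors in $\mathbb{Z}_\infty$ are $\pm1$. Pairs $(x,y),(x',y')\in\mathbb{Z}_\infty\times P$ are equivalent if $ux=vx'$, $uy=vy'$ for some nonzero $u,v$; each is equivalent to exactly one element of $\mathbb{Q}_\infty$, written $\overline{(x,y)}$. For $p=(a,b),q=(c,d)$: $p+q=\overline{(ad+bc,bd)}$, $-p=(-a,b)$, $pq=\overline{(ac,bd)}$, $p^{-1}=(b,a)$ if $0<a$, $(-b,-a)$ if $a<0$, $(0,1)$ if $a=0$; $p\le q$ iff the first coordinate of $q+(-p)$ is $\ge0$. An ordered field is a set-sized structure $\langle F,\preceq,+,-,\times,\div,0,1\rangle$ with $\preceq$ a total order, the operations functions on $F$, satisfying: $+$ and $\times$ associative and commutative, $a+0=a$, $a+(-a)=0$, $a1=a$, $a(b+c)=ab+ac$, ($a\prec b$, $c\prec d$ imply $a+c\prec b+d$), ($0\prec a$, $0\prec b$ imply $0\prec ab$), and every nonzero $a$ has $b$ with $ab=1$. *)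

theory Defs
  imports Main
begin

section \<open>The ambient universe of sets\<close>

text \<open>
  A type of this class is a universe of sets in which every HOL set over the type plays the role of
  a class. The axioms are those of NBG class theory without power set and choice; these two are not
  used by the constructions below, and leaving them out makes the class satisfiable inside HOL (the
  hereditarily countable sets are an instance), while every universe satisfying the full axioms is
  an instance as well.
\<close>

class set_universe =
  fixes elts :: "'a \<Rightarrow> 'a set"
  assumes extensionality: "elts x = elts y \<Longrightarrow> x = y"
    and foundation: "X \<noteq> {} \<Longrightarrow> \<exists>x\<in>X. elts x \<inter> X = {}"
    and pairing: "\<exists>z. elts z = {x, y}"
    and union: "\<exists>z. elts z = (\<Union>y\<in>elts x. elts y)"
    and separation: "\<exists>z. elts z = {y \<in> elts x. Q y}"
    and replacement: "\<exists>z. elts z = f ` elts x"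
    and infinity: "\<exists>z. (\<exists>e\<in>elts z. elts e = {}) \<and>
                       (\<forall>x\<in>elts z. \<exists>y\<in>elts z. elts y = insert x (elts x))"

definition is_set :: "'v::set_universe set \<Rightarrow> bool" where
  "is_set X \<longleftrightarrow> (\<exists>x. elts x = X)"

text \<open>\<open>vset X\<close> is meaningful only when \<open>is_set X\<close>.\<close>

definition vset :: "'v::set_universe set \<Rightarrow> 'v" where
  "vset X = (THE x. elts x = X)"

lemma vset_elts [simp]: "vset (elts x) = x"
  unfolding vset_def by (blast intro: extensionality)

lemma elts_vset: "is_set X \<Longrightarrow> elts (vset X) = X"
  unfolding is_set_def by auto

lemma wf_elts: "wf {(x, y :: 'v::set_universe). x \<in> elts y}"
proof (rule wfI_min)
  fix x :: 'v and X :: "'v set"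
  assume "x \<in> X"
  then obtain z where "z \<in> X" "elts z \<inter> X = {}"
    using foundation[of X] by blast
  then show "\<exists>z\<in>X. \<forall>y. (y, z) \<in> {(x, y). x \<in> elts y} \<longrightarrow> y \<notin> X"
    by blast
qed

definition vpair :: "'v::set_universe \<Rightarrow> 'v \<Rightarrow> 'v" where
  "vpair x y = vset {vset {x}, vset {x, y}}"

definition vfst :: "'v::set_universe \<Rightarrow> 'v" where
  "vfst p = (THE x. \<exists>y. p = vpair x y)"

definition vsnd :: "'v::set_universe \<Rightarrow> 'v" where
  "vsnd p = (THE y. \<exists>x. p = vpair x y)"

definition vtimes :: "'v::set_universe set \<Rightarrow> 'v set \<Rightarrow> 'v set" where
  "vtimes A B = {vpair x y | x y. x \<in> A \<and> y \<in> B}"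

definition is_function :: "'v::set_universe set \<Rightarrow> 'v set \<Rightarrow> 'v set \<Rightarrow> bool" where
  "is_function F A B \<longleftrightarrow> F \<subseteq> vtimes A B \<and> (\<forall>x\<in>A. \<exists>!y. vpair x y \<in> F)"

definition vapp :: "'v::set_universe \<Rightarrow> 'v \<Rightarrow> 'v" where
  "vapp f x = (THE y. vpair x y \<in> elts f)"

definition total_ordering :: "'v::set_universe set \<Rightarrow> 'v set \<Rightarrow> bool" where
  "total_ordering R A \<longleftrightarrow> R \<subseteq> vtimes A A \<and> linear_order_on A {(x, y). vpair x y \<in> R}"

section \<open>Ordinals\<close>

definition transitive_set :: "'v::set_universe \<Rightarrow> bool" where
  "transitive_set x \<longleftrightarrow> (\<forall>y\<in>elts x. elts y \<subseteq> elts x)"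

definition Ord :: "'v::set_universe \<Rightarrow> bool" where
  "Ord x \<longleftrightarrow> transitive_set x \<and> (\<forall>y\<in>elts x. transitive_set y)"

definition oless :: "'v::set_universe \<Rightarrow> 'v \<Rightarrow> bool" where
  "oless \<alpha> \<beta> \<longleftrightarrow> \<alpha> \<in> elts \<beta>"

definition ole :: "'v::set_universe \<Rightarrow> 'v \<Rightarrow> bool" where
  "ole \<alpha> \<beta> \<longleftrightarrow> oless \<alpha> \<beta> \<or> \<alpha> = \<beta>"

fun ord_of_nat :: "nat \<Rightarrow> 'v::set_universe" where
  "ord_of_nat 0 = vset {}"
| "ord_of_nat (Suc n) = vset (insert (ord_of_nat n) (elts (ord_of_nat n)))"

definition omega :: "'v::set_universe" where
  "omega = vset (range ord_of_nat)"

text \<open>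
  The usual (non-commutative) ordinal operations in von Neumann form:
  \<open>\<alpha> + \<beta> = \<alpha> \<union> {\<alpha> + \<gamma> | \<gamma> < \<beta>}\<close>,
  \<open>\<alpha> \<cdot> \<beta> = {\<alpha> \<cdot> \<gamma> + \<xi> | \<gamma> < \<beta>, \<xi> < \<alpha>}\<close>, and
  \<open>\<omega>\<close> to the power \<open>\<beta>\<close> is the supremum of \<open>1\<close> and all \<open>\<omega>\<^sup>\<gamma> \<cdot> \<omega>\<close> with \<open>\<gamma> < \<beta>\<close>.
\<close>

function oadd :: "'v::set_universe \<Rightarrow> 'v \<Rightarrow> 'v" where
  "oadd \<alpha> \<beta> = vset (elts \<alpha> \<union> (\<lambda>\<gamma>. oadd \<alpha> \<gamma>) ` elts \<beta>)"
  by auto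
termination
  by (relation "inv_image {(x, y). x \<in> elts y} snd") (auto simp: wf_elts)

declare oadd.simps [simp del]

function omul :: "'v::set_universe \<Rightarrow> 'v \<Rightarrow> 'v" where
  "omul \<alpha> \<beta> = vset (\<Union>\<gamma>\<in>elts \<beta>. (\<lambda>\<xi>. oadd (omul \<alpha> \<gamma>) \<xi>) ` elts \<alpha>)"
  by auto
termination
  by (relation "inv_image {(x, y). x \<in> elts y} snd") (auto simp: wf_elts)

declare omul.simps [simp del]

function omega_pow :: "'v::set_universe \<Rightarrow> 'v" where
  "omega_pow \<beta> = vset (elts (ord_of_nat 1) \<union> (\<Union>\<gamma>\<in>elts \<beta>. elts (omul (omega_pow \<gamma>) omega)))"
  by auto
termination
  by (relation "{(x, y). x \<in> elts y}") (auto simp: wf_elts)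

declare omega_pow.simps [simp del]

section \<open>Cantor normal forms and natural operations\<close>

text \<open>
  The list \<open>[(\<zeta>\<^sub>1, n\<^sub>1), \<dots>, (\<zeta>\<^sub>k, n\<^sub>k)]\<close> stands for
  \<open>\<omega>\<^bsup>\<zeta>\<^sub>1\<^esup> \<cdot> n\<^sub>1 + \<dots> + \<omega>\<^bsup>\<zeta>\<^sub>k\<^esup> \<cdot> n\<^sub>k\<close> with \<open>\<zeta>\<^sub>1 > \<dots> > \<zeta>\<^sub>k\<close> and all \<open>n\<^sub>i > 0\<close>.
\<close>

definition is_cnf :: "('v::set_universe \<times> nat) list \<Rightarrow> bool" where
  "is_cnf xs \<longleftrightarrow> sorted_wrt (\<lambda>p q. oless (fst q) (fst p)) xs \<and> (\<forall>(\<zeta>, n)\<in>set xs. Ord \<zeta> \<and> 0 < n)"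

definition cnf_value :: "('v::set_universe \<times> nat) list \<Rightarrow> 'v" where
  "cnf_value xs = foldr (\<lambda>(\<zeta>, n) s. oadd (omul (omega_pow \<zeta>) (ord_of_nat n)) s) xs (ord_of_nat 0)"

definition cnf :: "'v::set_universe \<Rightarrow> ('v \<times> nat) list" where
  "cnf \<alpha> = (THE xs. is_cnf xs \<and> cnf_value xs = \<alpha>)"

definition cnf_coeff :: "'v::set_universe \<Rightarrow> 'v \<Rightarrow> nat" where
  "cnf_coeff \<alpha> \<zeta> = (case map_of (cnf \<alpha>) \<zeta> of None \<Rightarrow> 0 | Some n \<Rightarrow> n)"

definition ord_of_coeffs :: "('v::set_universe \<Rightarrow> nat) \<Rightarrow> 'v" where
  "ord_of_coeffs c = (THE \<alpha>. Ord \<alpha> \<and> cnf_coeff \<alpha> = c)"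

definition nat_sum :: "'v::set_universe \<Rightarrow> 'v \<Rightarrow> 'v" (infixl "\<oplus>" 65) where
  "\<alpha> \<oplus> \<beta> = ord_of_coeffs (\<lambda>\<zeta>. cnf_coeff \<alpha> \<zeta> + cnf_coeff \<beta> \<zeta>)"

definition conv :: "('v::set_universe \<Rightarrow> 'r::comm_semiring_1) \<Rightarrow> ('v \<Rightarrow> 'r) \<Rightarrow> 'v \<Rightarrow> 'r" where
  "conv c d \<theta> = (\<Sum>(\<zeta>, \<eta>) | c \<zeta> \<noteq> 0 \<and> d \<eta> \<noteq> 0 \<and> \<zeta> \<oplus> \<eta> = \<theta>. c \<zeta> * d \<eta>)"

definition nat_prod :: "'v::set_universe \<Rightarrow> 'v \<Rightarrow> 'v" (infixl "\<otimes>" 70) where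
  "\<alpha> \<otimes> \<beta> = ord_of_coeffs (conv (cnf_coeff \<alpha>) (cnf_coeff \<beta>))"

definition times_number :: "'v::set_universe \<Rightarrow> bool" where
  "times_number \<kappa> \<longleftrightarrow>
     Ord \<kappa> \<and> ole omega \<kappa> \<and> (\<forall>\<beta> \<gamma>. oless \<beta> \<kappa> \<and> oless \<gamma> \<kappa> \<longrightarrow> oless (\<beta> \<otimes> \<gamma>) \<kappa>)"

section \<open>Surintegers\<close>

definition Z_inf :: "'v::set_universe set" where
  "Z_inf = {vpair \<alpha> \<beta> | \<alpha> \<beta>. Ord \<alpha> \<and> Ord \<beta> \<and> (\<forall>\<zeta>. cnf_coeff \<alpha> \<zeta> = 0 \<or> cnf_coeff \<beta> \<zeta> = 0)}"

text \<open>The two directions of the identification of pairs with finite formal sums.\<close>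

definition z_coeff :: "'v::set_universe \<Rightarrow> 'v \<Rightarrow> int" where
  "z_coeff a \<zeta> = int (cnf_coeff (vsnd a) \<zeta>) - int (cnf_coeff (vfst a) \<zeta>)"

definition z_of_coeffs :: "('v::set_universe \<Rightarrow> int) \<Rightarrow> 'v" where
  "z_of_coeffs c = vpair (ord_of_coeffs (\<lambda>\<zeta>. nat (- c \<zeta>))) (ord_of_coeffs (\<lambda>\<zeta>. nat (c \<zeta>)))"

definition z_add :: "'v::set_universe \<Rightarrow> 'v \<Rightarrow> 'v" where
  "z_add a b = z_of_coeffs (\<lambda>\<zeta>. z_coeff a \<zeta> + z_coeff b \<zeta>)"

definition z_neg :: "'v::set_universe \<Rightarrow> 'v" where
  "z_neg a = vpair (vsnd a) (vfst a)"

definition z_mul :: "'v::set_universe \<Rightarrow> 'v \<Rightarrow> 'v" where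
  "z_mul a b = z_of_coeffs (conv (z_coeff a) (z_coeff b))"

definition z_zero :: "'v::set_universe" where
  "z_zero = vpair (ord_of_nat 0) (ord_of_nat 0)"

definition z_one :: "'v::set_universe" where
  "z_one = vpair (ord_of_nat 0) (ord_of_nat 1)"

definition Z_nonneg :: "'v::set_universe set" where
  "Z_nonneg = {a \<in> Z_inf. ole (vfst a) (vsnd a)}"

definition Z_neg :: "'v::set_universe set" where
  "Z_neg = {a \<in> Z_inf. oless (vsnd a) (vfst a)}"

definition z_le :: "'v::set_universe \<Rightarrow> 'v \<Rightarrow> bool" where
  "z_le a b \<longleftrightarrow>
     (a \<in> Z_neg \<and> b \<in> Z_nonneg) \<or>
     (a \<in> Z_nonneg \<and> b \<in> Z_nonneg \<and>
        (oless (vsnd a) (vsnd b) \<or> (vsnd a = vsnd b \<and> ole (vfst b) (vfst a)))) \<or>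
     (a \<in> Z_neg \<and> b \<in> Z_neg \<and>
        (oless (vfst b) (vfst a) \<or> (vfst a = vfst b \<and> ole (vsnd a) (vsnd b))))"

text \<open>
  This order is not translation invariant (coordinates are compared separately), unlike the order of
  the surrationals below, which only uses the comparison with \<open>0\<close>.
\<close>

definition z_less :: "'v::set_universe \<Rightarrow> 'v \<Rightarrow> bool" where
  "z_less a b \<longleftrightarrow> z_le a b \<and> a \<noteq> b"

definition Z_below :: "'v::set_universe \<Rightarrow> 'v set" where
  "Z_below \<kappa> = {a \<in> Z_inf. oless (vfst a) \<kappa> \<and> oless (vsnd a) \<kappa>}"

definition z_dvd :: "'v::set_universe \<Rightarrow> 'v \<Rightarrow> bool" where
  "z_dvd d a \<longleftrightarrow> (\<exists>e\<in>Z_inf. a = z_mul d e)"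

section \<open>Surrationals\<close>

definition Z_pos :: "'v::set_universe set" where
  "Z_pos = Z_nonneg - {z_zero}"

definition Q_inf :: "'v::set_universe set" where
  "Q_inf = {vpair a b | a b. a \<in> Z_inf \<and> b \<in> Z_pos \<and>
              (\<forall>d\<in>Z_inf. z_dvd d a \<and> z_dvd d b \<longrightarrow> d = z_one \<or> d = z_neg z_one)}"

definition frac_equiv :: "'v::set_universe \<Rightarrow> 'v \<Rightarrow> bool" where
  "frac_equiv p q \<longleftrightarrow> p \<in> vtimes Z_inf Z_pos \<and> q \<in> vtimes Z_inf Z_pos \<and>
     (\<exists>u\<in>Z_inf. \<exists>v\<in>Z_inf. u \<noteq> z_zero \<and> v \<noteq> z_zero \<and>
        z_mul u (vfst p) = z_mul v (vfst q) \<and> z_mul u (vsnd p) = z_mul v (vsnd q))"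

definition reduced :: "'v::set_universe \<Rightarrow> 'v \<Rightarrow> 'v" where
  "reduced x y = (THE q. q \<in> Q_inf \<and> frac_equiv (vpair x y) q)"

definition q_add :: "'v::set_universe \<Rightarrow> 'v \<Rightarrow> 'v" where
  "q_add p q = reduced (z_add (z_mul (vfst p) (vsnd q)) (z_mul (vsnd p) (vfst q)))
                       (z_mul (vsnd p) (vsnd q))"

definition q_neg :: "'v::set_universe \<Rightarrow> 'v" where
  "q_neg p = vpair (z_neg (vfst p)) (vsnd p)"

definition q_mul :: "'v::set_universe \<Rightarrow> 'v \<Rightarrow> 'v" where
  "q_mul p q = reduced (z_mul (vfst p) (vfst q)) (z_mul (vsnd p) (vsnd q))"

definition q_inv :: "'v::set_universe \<Rightarrow> 'v" where
  "q_inv p =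
     (if z_less z_zero (vfst p) then vpair (vsnd p) (vfst p)
      else if z_less (vfst p) z_zero then vpair (z_neg (vsnd p)) (z_neg (vfst p))
      else vpair z_zero z_one)"

definition q_le :: "'v::set_universe \<Rightarrow> 'v \<Rightarrow> bool" where
  "q_le p q \<longleftrightarrow> z_le z_zero (vfst (q_add q (q_neg p)))"

definition q_zero :: "'v::set_universe" where
  "q_zero = vpair z_zero z_one"

definition q_one :: "'v::set_universe" where
  "q_one = vpair z_one z_one"

section \<open>Ordered fields and the structures below a bound\<close>

definition structure_tuple ::
  "'v::set_universe \<Rightarrow> 'v \<Rightarrow> 'v \<Rightarrow> 'v \<Rightarrow> 'v \<Rightarrow> 'v \<Rightarrow> 'v \<Rightarrow> 'v \<Rightarrow> 'v" where
  "structure_tuple F le pls neg tms rcp z e =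
     vpair F (vpair le (vpair pls (vpair neg (vpair tms (vpair rcp (vpair z e))))))"

text \<open>
  The structure is an element of the universe, hence set-sized. Note that \<open>0 \<noteq> 1\<close> is not among the
  axioms, and that the unary operation \<open>\<div>\<close> is only required to be a function on the carrier.
\<close>

definition ordered_field :: "'v::set_universe \<Rightarrow> bool" where
  "ordered_field S \<longleftrightarrow>
     (\<exists>F le pls neg tms rcp z e.
        S = structure_tuple F le pls neg tms rcp z e \<and>
        (let A = elts F;
             add = (\<lambda>a b. vapp pls (vpair a b));
             mul = (\<lambda>a b. vapp tms (vpair a b));
             less = (\<lambda>a b. vpair a b \<in> elts le \<and> a \<noteq> b)
         in total_ordering (elts le) A \<and>
            is_function (elts pls) (vtimes A A) A \<and>
            is_function (elts neg) A A \<and>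
            is_function (elts tms) (vtimes A A) A \<and>
            is_function (elts rcp) A A \<and>
            z \<in> A \<and> e \<in> A \<and>
            (\<forall>a\<in>A. \<forall>b\<in>A. \<forall>c\<in>A. add (add a b) c = add a (add b c)) \<and>
            (\<forall>a\<in>A. \<forall>b\<in>A. add a b = add b a) \<and>
            (\<forall>a\<in>A. \<forall>b\<in>A. \<forall>c\<in>A. mul (mul a b) c = mul a (mul b c)) \<and>
            (\<forall>a\<in>A. \<forall>b\<in>A. mul a b = mul b a) \<and>
            (\<forall>a\<in>A. add a z = a) \<and>
            (\<forall>a\<in>A. add a (vapp neg a) = z) \<and>
            (\<forall>a\<in>A. mul a e = a) \<and>
            (\<forall>a\<in>A. \<forall>b\<in>A. \<forall>c\<in>A. mul a (add b c) = add (mul a b) (mul a c)) \<and>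
            (\<forall>a\<in>A. \<forall>b\<in>A. \<forall>c\<in>A. \<forall>d\<in>A. less a b \<and> less c d \<longrightarrow> less (add a c) (add b d)) \<and>
            (\<forall>a\<in>A. \<forall>b\<in>A. less z a \<and> less z b \<longrightarrow> less z (mul a b)) \<and>
            (\<forall>a\<in>A. a \<noteq> z \<longrightarrow> (\<exists>b\<in>A. mul a b = e))))"

definition restrict_rel :: "('v::set_universe \<Rightarrow> 'v \<Rightarrow> bool) \<Rightarrow> 'v set \<Rightarrow> 'v set" where
  "restrict_rel R A = {vpair x y | x y. x \<in> A \<and> y \<in> A \<and> R x y}"

definition restrict_unary :: "('v::set_universe \<Rightarrow> 'v) \<Rightarrow> 'v set \<Rightarrow> 'v set" where
  "restrict_unary f A = {vpair x (f x) | x. x \<in> A}"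

definition restrict_binary :: "('v::set_universe \<Rightarrow> 'v \<Rightarrow> 'v) \<Rightarrow> 'v set \<Rightarrow> 'v set" where
  "restrict_binary f A = {vpair (vpair x y) (f x y) | x y. x \<in> A \<and> y \<in> A}"

definition Q_below :: "'v::set_universe \<Rightarrow> 'v set" where
  "Q_below \<kappa> = {vpair a b | a b. vpair a b \<in> Q_inf \<and> a \<in> Z_below \<kappa> \<and> b \<in> Z_below \<kappa>}"

definition le_below :: "'v::set_universe \<Rightarrow> 'v set" where
  "le_below \<kappa> = restrict_rel q_le (Q_below \<kappa>)"

definition add_below :: "'v::set_universe \<Rightarrow> 'v set" where
  "add_below \<kappa> = restrict_binary q_add (Q_below \<kappa>)"

definition neg_below :: "'v::set_universe \<Rightarrow> 'v set" where
  "neg_below \<kappa> = restrict_unary q_neg (Q_below \<kappa>)"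

definition mul_below :: "'v::set_universe \<Rightarrow> 'v set" where
  "mul_below \<kappa> = restrict_binary q_mul (Q_below \<kappa>)"

definition inv_below :: "'v::set_universe \<Rightarrow> 'v set" where
  "inv_below \<kappa> = restrict_unary q_inv (Q_below \<kappa>)"

definition Q_structure :: "'v::set_universe \<Rightarrow> 'v" where
  "Q_structure \<kappa> =
     structure_tuple (vset (Q_below \<kappa>)) (vset (le_below \<kappa>)) (vset (add_below \<kappa>))
       (vset (neg_below \<kappa>)) (vset (mul_below \<kappa>)) (vset (inv_below \<kappa>)) q_zero q_one"

end

theory Submission
  imports
    Defs
    "HOL-Library.Poly_Mapping"
    "HOL-Computational_Algebra.Primes"
    "HOL-Computational_Algebra.Fraction_Field"
begin

text \<open>
  By the Cantor normal form, ordinals under natural addition are the free commutative monoid on the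
  powers \<open>\<omega>\<^sup>\<zeta>\<close>, so the surintegers are the ring of integer polynomials in a proper class of
  variables, and their sign is the sign of the leading coefficient. Existence and uniqueness of
  reduced fractions amount to unique factorisation in this ring; since an element involves only
  finitely many variables, this follows by adjoining one variable at a time. Hence
  \<open>\<rat>\<^sub>\<infinity>\<close> is the fraction field, ordered by leading coefficients. For a \<open>\<times>\<close>-number
  \<open>\<lambda>\<close> the exponents \<open>\<zeta>\<close> with \<open>\<omega>\<^sup>\<zeta> < \<lambda>\<close> are closed under natural addition and
  downward closed, so the polynomials with exponents among them form a subring containing all
  divisors of its nonzero elements, and \<open>\<rat>\<^sub>\<lambda>\<close> is its fraction field. Finally every ordinal lies below
  the \<open>\<times>\<close>-number \<open>\<omega>\<close> to the power \<open>\<omega>\<^sup>\<gamma>\<close> for some \<open>\<gamma>\<close>, so a set of all these fields would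
  yield a set of all ordinals.
\<close>

section \<open>Sets and pairs\<close>

text \<open>Two obstacles shape the proof. The definitions select sums, products and reduced
  fractions with \<open>THE\<close>, so nothing can be calculated until Cantor normal forms and
  lowest terms are known to exist uniquely. Comparing normal forms lexicographically settles the
  former and makes natural addition strictly monotone, so that leading terms multiply without
  cancelling. The other obstacle is that neither Euclidean division nor Bezout identities are
  available in several variables, so irreducibles are shown to be prime directly. On passing from S
  to \<open>insert i S\<close>, irreducibles without the new variable stay prime by Gauss's argument
  on top coefficients; those that involve it are treated by division over the fraction field of the
  old ring, with denominators cleared. The induction starts from the integers. The field laws and
  the order are proved in the fraction field of the whole ring and pulled back along
  \<open>qval\<close>, which is injective on reduced pairs.\<close>

lemma is_set_elts [simp]: "is_set (elts x)"
  unfolding is_set_def by blast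

lemma is_set_subset: "is_set B \<Longrightarrow> A \<subseteq> B \<Longrightarrow> is_set A"
proof -
  assume "is_set B" and AB: "A \<subseteq> B"
  then obtain x where "elts x = B"
    unfolding is_set_def by blast
  moreover obtain z where "elts z = {y \<in> elts x. y \<in> A}"
    using separation[of x "\<lambda>y. y \<in> A"] by blast
  ultimately have "elts z = A"
    using AB by blast
  then show "is_set A"
    unfolding is_set_def by blast
qed

lemma is_set_empty [simp]: "is_set {}"
  by (rule is_set_subset[OF is_set_elts]) simp

lemma is_set_doubleton [simp]: "is_set {x, y}"
  using pairing unfolding is_set_def by blast

lemma is_set_singleton [simp]: "is_set {x}"
  using is_set_doubleton[of x x] by simp

lemma is_set_image [intro]:
  fixes f :: "'v::set_universe \<Rightarrow> 'v"
  shows "is_set A \<Longrightarrow> is_set (f ` A)"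
proof -
  assume "is_set A"
  then obtain x where "elts x = A"
    unfolding is_set_def by blast
  with replacement[of f x] show "is_set (f ` A)"
    unfolding is_set_def by simp
qed

lemma is_set_UN [intro]:
  fixes f :: "'v::set_universe \<Rightarrow> 'v set"
  assumes "is_set A" "\<And>x. x \<in> A \<Longrightarrow> is_set (f x)"
  shows "is_set (\<Union>x\<in>A. f x)"
proof -
  \<comment> \<open>Replacement collects only elements of the universe, so it is applied to the
    codes \<open>vset (f x)\<close>.\<close>
  obtain a where a: "elts a = (\<lambda>x. vset (f x)) ` A"
    using is_set_image[OF assms(1), of "\<lambda>x. vset (f x)"] unfolding is_set_def by blast
  obtain z where "elts z = (\<Union>y\<in>elts a. elts y)"
    using union[of a] by blast
  also have "\<dots> = (\<Union>x\<in>A. f x)"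
    using assms(2) by (simp add: a elts_vset)
  finally show ?thesis
    unfolding is_set_def by blast
qed

lemma is_set_Un [intro]: "is_set A \<Longrightarrow> is_set B \<Longrightarrow> is_set (A \<union> B)"
  using is_set_UN[of "{vset A, vset B}" elts] by (simp add: elts_vset)

lemma is_set_insert [intro, simp]: "is_set A \<Longrightarrow> is_set (insert x A)"
  using is_set_Un[of "{x}" A] by simp

lemma vset_eq_iff: "is_set A \<Longrightarrow> is_set B \<Longrightarrow> vset A = vset B \<longleftrightarrow> A = B"
  by (metis elts_vset)

lemma vpair_eq_iff [simp]: "vpair x y = vpair x' y' \<longleftrightarrow> x = x' \<and> y = y'"
  unfolding vpair_def by (auto simp: vset_eq_iff doubleton_eq_iff)

lemma vfst_vpair [simp]: "vfst (vpair x y) = x"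
  unfolding vfst_def by auto

lemma vsnd_vpair [simp]: "vsnd (vpair x y) = y"
  unfolding vsnd_def by auto

lemma vpair_in_vtimes [simp]: "vpair x y \<in> vtimes A B \<longleftrightarrow> x \<in> A \<and> y \<in> B"
  unfolding vtimes_def by auto

text \<open>Power set is not among the axioms, so the product is built by replacement and union
  instead of being separated from a larger set.\<close>

lemma is_set_vtimes: "is_set A \<Longrightarrow> is_set B \<Longrightarrow> is_set (vtimes A B)"
proof -
  assume "is_set A" "is_set B"
  then have "is_set (\<Union>x\<in>A. vpair x ` B)"
    by blast
  moreover have "(\<Union>x\<in>A. vpair x ` B) = vtimes A B"
    unfolding vtimes_def by auto
  ultimately show ?thesis by simp
qed

section \<open>Ordinal arithmetic\<close>

lemma Ord_elem: "Ord x \<Longrightarrow> y \<in> elts x \<Longrightarrow> Ord y"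
  unfolding Ord_def transitive_set_def by blast

lemma Ord_trans: "Ord z \<Longrightarrow> x \<in> elts y \<Longrightarrow> y \<in> elts z \<Longrightarrow> x \<in> elts z"
  unfolding Ord_def transitive_set_def by blast

lemma OrdI: "(\<And>y. y \<in> elts x \<Longrightarrow> Ord y) \<Longrightarrow> (\<And>y. y \<in> elts x \<Longrightarrow> elts y \<subseteq> elts x) \<Longrightarrow> Ord x"
  unfolding Ord_def transitive_set_def by blast

lemma elem_irrefl: "x \<notin> elts x"
  using wf_not_refl[OF wf_elts] by force

lemma elem_asym: "x \<in> elts y \<Longrightarrow> y \<notin> elts x"
  using wf_not_sym[OF wf_elts] by force

lemmas elts_induct = wf_induct_rule[OF wf_elts, simplified, case_names elem]

text \<open>Nested induction on both arguments: if x and y are incomparable, the outer hypothesis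
  puts every element of x into y, the inner one every element of y into x, and extensionality makes
  them equal.\<close>

lemma Ord_linear: "Ord x \<Longrightarrow> Ord y \<Longrightarrow> x \<in> elts y \<or> x = y \<or> y \<in> elts x"
proof (induction x arbitrary: y rule: elts_induct)
  case (elem x)
  note IHx = elem.IH
  from elem.prems(2) show ?case
  proof (induction y rule: elts_induct)
    case (elem y)
    show ?case
    proof (rule ccontr)
      assume neg: "\<not> ?case"
      have "elts x \<subseteq> elts y"
        using IHx neg Ord_elem \<open>Ord x\<close> \<open>Ord y\<close> Ord_trans by blast
      moreover have "elts y \<subseteq> elts x"
        using elem.IH neg Ord_elem \<open>Ord x\<close> \<open>Ord y\<close> Ord_trans by blast
      ultimately show False
        using neg extensionality by blast
    qed
  qed
qed

lemma ole_iff_subset: "Ord x \<Longrightarrow> Ord y \<Longrightarrow> ole x y \<longleftrightarrow> elts x \<subseteq> elts y"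
  unfolding ole_def oless_def using Ord_linear[of x y] Ord_trans elem_irrefl by blast

lemma elts_zero [simp]: "elts (vset {}) = {}"
  by (simp add: elts_vset)

lemma elts_ord_of_nat_Suc: "elts (ord_of_nat (Suc n)) = insert (ord_of_nat n) (elts (ord_of_nat n))"
  by (simp add: elts_vset)

declare ord_of_nat.simps(2) [simp del]

lemma elts_ord_of_nat: "elts (ord_of_nat n) = ord_of_nat ` {..<n}"
  by (induction n) (auto simp: elts_ord_of_nat_Suc lessThan_Suc)

lemma is_set_range_ord_of_nat: "is_set (range ord_of_nat)"
proof -
  obtain z :: 'a where z: "\<exists>e\<in>elts z. elts e = {}"
      "\<forall>x\<in>elts z. \<exists>y\<in>elts z. elts y = insert x (elts x)"
    using infinity by blast
  have "ord_of_nat n \<in> elts z" for n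
  proof (induction n)
    case 0
    then show ?case
      using z(1) by (metis ord_of_nat.simps(1) vset_elts)
  next
    case (Suc n)
    then show ?case
      using z(2) by (metis ord_of_nat.simps(2) vset_elts)
  qed
  then show ?thesis
    by (intro is_set_subset[OF is_set_elts[of z]]) blast
qed

lemma elts_omega: "elts omega = range ord_of_nat"
  unfolding omega_def by (simp add: elts_vset is_set_range_ord_of_nat)

lemma elts_oadd: "elts (oadd a b) = elts a \<union> oadd a ` elts b"
  by (subst oadd.simps) (simp add: elts_vset is_set_Un is_set_image)

lemma elts_omul: "elts (omul a b) = (\<Union>c\<in>elts b. oadd (omul a c) ` elts a)"
  by (subst omul.simps) (simp add: elts_vset is_set_UN is_set_image)

lemma elts_omega_pow: "elts (omega_pow b) = insert (vset {}) (\<Union>c\<in>elts b. elts (omul (omega_pow c) omega))"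
proof -
  have 1: "elts (ord_of_nat (Suc 0)) = {vset {}}"
    by (simp add: elts_ord_of_nat_Suc)
  show ?thesis
    by (subst omega_pow.simps, subst elts_vset) (auto simp: 1 intro!: is_set_insert is_set_UN)
qed

lemma Ord_zero [simp]: "Ord (vset {})"
  by (simp add: Ord_def transitive_set_def)

lemma Ord_succ: "Ord x \<Longrightarrow> elts y = insert x (elts x) \<Longrightarrow> Ord y"
  by (rule OrdI) (auto dest: Ord_elem Ord_trans)

lemma Ord_ord_of_nat [simp]: "Ord (ord_of_nat n)"
  by (induction n) (auto intro: Ord_succ[OF _ elts_ord_of_nat_Suc])

lemma Ord_omega [simp]: "Ord omega"
  by (rule OrdI) (auto simp: elts_omega elts_ord_of_nat)

lemma Ord_oadd [simp]: "Ord a \<Longrightarrow> Ord b \<Longrightarrow> Ord (oadd a b)"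
proof (induction b rule: elts_induct)
  case (elem b)
  show ?case
  proof (rule OrdI)
    fix y assume "y \<in> elts (oadd a b)"
    then consider "y \<in> elts a" | c where "c \<in> elts b" "y = oadd a c"
      by (auto simp: elts_oadd)
    then have "Ord y \<and> elts y \<subseteq> elts (oadd a b)"
    proof cases
      case 1
      then show ?thesis
        using elem.prems(1) Ord_elem Ord_trans[of a] by (auto simp: elts_oadd)
    next
      case 2
      then show ?thesis
        using elem.IH[of c] elem.prems Ord_elem[of b] Ord_trans[of b] by (auto simp: elts_oadd)
    qed
    then show "Ord y" "elts y \<subseteq> elts (oadd a b)"
      by auto
  qed
qed

lemma omul_mono: "elts b \<subseteq> elts c \<Longrightarrow> elts (omul a b) \<subseteq> elts (omul a c)"
  by (auto simp: elts_omul)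

lemma Ord_omul [simp]: "Ord a \<Longrightarrow> Ord b \<Longrightarrow> Ord (omul a b)"
proof (induction b rule: elts_induct)
  case (elem b)
  show ?case
  proof (rule OrdI)
    fix y assume "y \<in> elts (omul a b)"
    then obtain c d where cd: "c \<in> elts b" "d \<in> elts a" "y = oadd (omul a c) d"
      by (auto simp: elts_omul)
    then show "Ord y"
      using elem.IH[of c] elem.prems Ord_elem[of a d] Ord_elem[of b c] by auto
    have "elts (omul a c) \<subseteq> elts (omul a b)"
      using cd(1) elem.prems Ord_trans by (intro omul_mono) blast
    moreover have "oadd (omul a c) ` elts d \<subseteq> oadd (omul a c) ` elts a"
      using cd elem.prems Ord_trans[of a] by blast
    then have "oadd (omul a c) ` elts d \<subseteq> elts (omul a b)"
      using cd(1) unfolding elts_omul[of a b] by blast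
    ultimately show "elts y \<subseteq> elts (omul a b)"
      by (simp add: cd(3) elts_oadd)
  qed
qed

lemma Ord_omega_pow [simp]: "Ord b \<Longrightarrow> Ord (omega_pow b)"
proof (induction b rule: elts_induct)
  case (elem b)
  then have *: "Ord (omul (omega_pow c) omega)" if "c \<in> elts b" for c
    using that Ord_elem by (metis Ord_omul Ord_omega)
  show ?case
    by (rule OrdI) (use * in \<open>auto simp: elts_omega_pow dest: Ord_elem Ord_trans\<close>)
qed

lemma zero_in_omega_pow: "vset {} \<in> elts (omega_pow b)"
  by (simp add: elts_omega_pow)

lemma oadd_zero_right [simp]: "oadd a (vset {}) = a"
  by (rule extensionality) (simp add: elts_oadd)

lemma oadd_zero_left [simp]: "oadd (vset {}) b = b"
proof (induction b rule: elts_induct)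
  case (elem b)
  then show ?case
    by (intro extensionality) (auto simp: elts_oadd)
qed

lemma omul_zero_right [simp]: "omul a (vset {}) = vset {}"
  by (rule extensionality) (simp add: elts_omul)

text \<open>\<open>n = 0\<close> is allowed, so \<open>c\<close> need not be the leading exponent of \<open>y\<close>.\<close>

lemma elem_omega_pow_iff:
  "y \<in> elts (omega_pow b) \<longleftrightarrow> y = vset {} \<or>
     (\<exists>c n r. c \<in> elts b \<and> r \<in> elts (omega_pow c) \<and> y = oadd (omul (omega_pow c) (ord_of_nat n)) r)"
  unfolding elts_omega_pow[of b] by (auto simp: elts_omul elts_omega)

lemma omul_step:
  "r \<in> elts a \<Longrightarrow> n < m \<Longrightarrow> oadd (omul a (ord_of_nat n)) r \<in> elts (omul a (ord_of_nat m))"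
  by (auto simp: elts_omul elts_ord_of_nat)

text \<open>Places every ordinal a inside \<open>omega_pow (osucc a)\<close>, which gives
  \<open>cnf_exists_below\<close> a bound to start from.\<close>

lemma omega_pow_ge: "Ord b \<Longrightarrow> elts b \<subseteq> elts (omega_pow b)"
proof (induction b rule: elts_induct)
  case (elem b)
  show ?case
  proof
    fix c assume c: "c \<in> elts b"
    then have Oc: "Ord c"
      using elem.prems Ord_elem by blast
    have "elts c \<subseteq> elts (omega_pow c)"
      using elem c Oc by blast
    moreover have *: "omega_pow c \<in> elts (omega_pow b)"
    proof -
      \<comment> \<open>The power itself has the shape required by
        \<open>elem_omega_pow_iff\<close>, with multiplicity 1 and remainder 0.\<close>
      have "omega_pow c = oadd (omul (omega_pow c) (ord_of_nat 1)) (vset {})"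
        by (intro extensionality) (simp add: elts_omul elts_ord_of_nat lessThan_Suc)
      then show ?thesis
        using c zero_in_omega_pow[of c] unfolding elem_omega_pow_iff[of _ b] by blast
    qed
    ultimately have "ole c (omega_pow c)"
      using Oc by (simp add: ole_iff_subset)
    then show "c \<in> elts (omega_pow b)"
      using * Ord_trans[OF Ord_omega_pow[OF elem.prems], of c "omega_pow c"]
      unfolding ole_def oless_def by auto
  qed
qed

section \<open>Cantor normal forms\<close>

lemma cnf_value_Nil [simp]: "cnf_value [] = vset {}"
  by (simp add: cnf_value_def)

lemma cnf_value_Cons [simp]:
  "cnf_value ((z, n) # xs) = oadd (omul (omega_pow z) (ord_of_nat n)) (cnf_value xs)"
  by (simp add: cnf_value_def)

lemma is_cnf_Nil [simp]: "is_cnf []"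
  by (simp add: is_cnf_def)

lemma is_cnf_Cons [simp]:
  "is_cnf ((z, n) # xs) \<longleftrightarrow> (\<forall>p\<in>set xs. fst p \<in> elts z) \<and> Ord z \<and> 0 < n \<and> is_cnf xs"
  by (auto simp: is_cnf_def oless_def)

lemma Ord_cnf_value [simp]: "is_cnf xs \<Longrightarrow> Ord (cnf_value xs)"
  by (induction xs) auto

lemma omega_pow_step:
  "c \<in> elts b \<Longrightarrow> r \<in> elts (omega_pow c) \<Longrightarrow> oadd (omul (omega_pow c) (ord_of_nat n)) r \<in> elts (omega_pow b)"
  unfolding elem_omega_pow_iff[of _ b] by blast

text \<open>The bound b varies in the induction: the tail of a normal form lies below the power of
  its own leading exponent, and \<open>omega_pow_step\<close> then adds the leading term.\<close>

lemma cnf_value_less: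
  "is_cnf xs \<Longrightarrow> (\<forall>p\<in>set xs. fst p \<in> elts b) \<Longrightarrow> cnf_value xs \<in> elts (omega_pow b)"
proof (induction xs arbitrary: b)
  case Nil
  then show ?case by (simp add: zero_in_omega_pow)
next
  case (Cons p xs)
  then show ?case
    by (cases p) (auto intro: omega_pow_step)
qed

text \<open>Recording that the exponents stay below b is what allows the leading exponent c to be
  put in front of the list found for the remainder.\<close>

lemma cnf_exists_below:
  "Ord b \<Longrightarrow> y \<in> elts (omega_pow b) \<Longrightarrow>
     \<exists>xs. is_cnf xs \<and> (\<forall>p\<in>set xs. fst p \<in> elts b) \<and> cnf_value xs = y"
proof (induction b arbitrary: y rule: elts_induct)
  case (elem b)
  from \<open>y \<in> elts (omega_pow b)\<close> consider "y = vset {}"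
    | c n r where "c \<in> elts b" "r \<in> elts (omega_pow c)" "y = oadd (omul (omega_pow c) (ord_of_nat n)) r"
    unfolding elem_omega_pow_iff[of y b] by blast
  then show ?case
  proof cases
    case 1
    then show ?thesis by (intro exI[of _ "[]"]) simp
  next
    case 2
    then obtain xs where xs: "is_cnf xs" "\<forall>p\<in>set xs. fst p \<in> elts c" "cnf_value xs = r"
      using elem.IH[of c r] elem.prems Ord_elem[of b c] by blast
    have b: "\<forall>p\<in>set xs. fst p \<in> elts b"
      using xs(2) 2(1) Ord_trans[OF elem.prems(1)] by blast
    show ?thesis
    \<comment> \<open>A normal form admits no zero multiplicity, so for n = 0 the list of the
      remainder itself is taken.\<close>
    proof (cases "n = 0")
      case True
      then show ?thesis using 2 xs b by auto
    next
      case False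
      then show ?thesis
        using 2 xs b elem.prems Ord_elem[of b c] by (intro exI[of _ "(c, n) # xs"]) auto
    qed
  qed
qed

section \<open>Coefficients and the lexicographic comparison of normal forms\<close>

definition coeff_of :: "('v::set_universe \<times> nat) list \<Rightarrow> 'v \<Rightarrow> nat" where
  "coeff_of xs z = (case map_of xs z of None \<Rightarrow> 0 | Some n \<Rightarrow> n)"

lemma coeff_of_Nil [simp]: "coeff_of [] z = 0"
  by (simp add: coeff_of_def)

lemma coeff_of_Cons [simp]: "coeff_of ((y, n) # xs) z = (if z = y then n else coeff_of xs z)"
  by (simp add: coeff_of_def)

lemma coeff_of_nonzero: "coeff_of xs z \<noteq> 0 \<Longrightarrow> z \<in> fst ` set xs"
  by (induction xs) (auto split: if_splits)

lemma coeff_of_eq_0_above: "(\<forall>p\<in>set xs. fst p \<in> elts b) \<Longrightarrow> Ord b \<Longrightarrow> z = b \<or> b \<in> elts z \<Longrightarrow> coeff_of xs z = 0"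
  using coeff_of_nonzero[of xs z] elem_irrefl elem_asym by fastforce

text \<open>Decided at the highest place of difference. Since that place is an ordinal, any two
  candidates are comparable, which gives \<open>lex_less_asym\<close>.\<close>

definition lex_less :: "('v::set_universe \<Rightarrow> nat) \<Rightarrow> ('v \<Rightarrow> nat) \<Rightarrow> bool" where
  "lex_less c d \<longleftrightarrow> (\<exists>z. Ord z \<and> c z < d z \<and> (\<forall>y. z \<in> elts y \<longrightarrow> c y = d y))"

text \<open>Each strict alternative couples the comparison of coefficients with that of values. As
  both relations are asymmetric, uniqueness of normal forms and the equivalence
  \<open>oless_iff_lex_less\<close> follow without a separate converse.\<close>

lemma cnf_cases_less:
  assumes "is_cnf xs" "is_cnf ys"
  shows "xs = ys \<or>
    (lex_less (coeff_of xs) (coeff_of ys) \<and> cnf_value xs \<in> elts (cnf_value ys)) \<or>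
    (lex_less (coeff_of ys) (coeff_of xs) \<and> cnf_value ys \<in> elts (cnf_value xs))"
  using assms
proof (induction xs arbitrary: ys)
  case Nil
  show ?case
  proof (cases ys)
    case (Cons p ys')
    obtain z n where p: "p = (z, n)" by force
    have z: "Ord z" "0 < n" "\<forall>p\<in>set ys'. fst p \<in> elts z" "is_cnf ys'"
      using Nil Cons p by auto
    have "vset {} \<in> elts (omul (omega_pow z) (ord_of_nat n))"
      using omul_step[OF zero_in_omega_pow, of 0 n z] z by simp
    moreover have "lex_less (coeff_of []) (coeff_of ys)"
      unfolding lex_less_def
      by (rule exI[of _ z]) (use z coeff_of_eq_0_above[of ys' z] in \<open>auto simp: Cons p elem_irrefl\<close>)
    ultimately show ?thesis
      by (simp add: Cons p elts_oadd del: coeff_of_Nil coeff_of_Cons)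
  qed simp
next
  case (Cons p xs)
  obtain z n where p: "p = (z, n)" by force
  have z: "Ord z" "0 < n" "\<forall>p\<in>set xs. fst p \<in> elts z" "is_cnf xs"
    using Cons.prems p by auto
  let ?v = "\<lambda>z n. omul (omega_pow z) (ord_of_nat n)"
  \<comment> \<open>The larger head wins whatever the tails are: the tail xs contributes less than
    \<open>omega_pow z\<close>, so the left value stays below the leading term of the right
    one.\<close>
  have headless: "lex_less (coeff_of ((z, n) # xs)) (coeff_of ((y, m) # ys)) \<and>
      cnf_value ((z, n) # xs) \<in> elts (cnf_value ((y, m) # ys))"
    if z: "is_cnf ((z, n) # xs)" and y: "is_cnf ((y, m) # ys)" and less: "z \<in> elts y \<or> z = y \<and> n < m"
    for z y :: 'a and n m :: nat and xs ys
  proof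
    show "lex_less (coeff_of ((z, n) # xs)) (coeff_of ((y, m) # ys))"
      unfolding lex_less_def
    proof (rule exI[of _ y], intro conjI allI impI)
      have "coeff_of ((z, n) # xs) y < m"
      proof (cases "z = y")
        case False
        then show ?thesis
          using that coeff_of_eq_0_above[of xs z y] by (auto simp: elem_irrefl)
      qed (use less elem_irrefl in auto)
      then show "coeff_of ((z, n) # xs) y < coeff_of ((y, m) # ys) y"
        by simp
      fix t assume t: "y \<in> elts t"
      have "t \<noteq> y" "t \<noteq> z"
        using t less elem_irrefl elem_asym by blast+
      moreover have "\<forall>p\<in>set xs. fst p \<in> elts y"
        using less z y Ord_trans[of y] by auto
      ultimately show "coeff_of ((z, n) # xs) t = coeff_of ((y, m) # ys) t"
        using t y coeff_of_eq_0_above[of xs y t] coeff_of_eq_0_above[of ys y t] by simp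
    qed (use y in simp)
    have r: "cnf_value xs \<in> elts (omega_pow z)"
      using z by (intro cnf_value_less) auto
    have "cnf_value ((z, n) # xs) \<in> elts (?v y m)"
      using less
    proof
      assume zy: "z \<in> elts y"
      have "cnf_value ((z, n) # xs) \<in> elts (omega_pow y)"
        using r zy by (simp add: omega_pow_step)
      then show ?thesis
        using omul_step[of _ "omega_pow y" 0 m] y by simp
    next
      assume "z = y \<and> n < m"
      then show ?thesis
        using omul_step[OF r] by simp
    qed
    then show "cnf_value ((z, n) # xs) \<in> elts (cnf_value ((y, m) # ys))"
      by (simp add: elts_oadd)
  qed
  show ?case
  proof (cases ys)
    case Nil
    have "vset {} \<in> elts (?v z n)"
      using omul_step[OF zero_in_omega_pow, of 0 n z] z by simp
    moreover have "lex_less (coeff_of ys) (coeff_of (p # xs))"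
      unfolding lex_less_def
      by (rule exI[of _ z]) (use z coeff_of_eq_0_above[of xs z] in \<open>auto simp: Nil p elem_irrefl\<close>)
    ultimately show ?thesis
      by (simp add: Nil p elts_oadd del: coeff_of_Nil coeff_of_Cons)
  next
    case (Cons q ys')
    obtain y m where q: "q = (y, m)" by force
    have y: "Ord y" "0 < m" "\<forall>p\<in>set ys'. fst p \<in> elts y" "is_cnf ys'"
      using Cons.prems Cons q by auto
    consider "z \<in> elts y \<or> z = y \<and> n < m" | "y \<in> elts z \<or> y = z \<and> m < n" | "z = y" "n = m"
      using Ord_linear[OF z(1) y(1)] by (cases n m rule: linorder_cases) auto
    then show ?thesis
    proof cases
      case 1
      then show ?thesis
        using headless[of z n xs y m ys'] z y by (simp add: Cons p q del: coeff_of_Cons)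
    next
      case 2
      then show ?thesis
        using headless[of y m ys' z n xs] z y by (simp add: Cons p q del: coeff_of_Cons)
    next
      case 3
      \<comment> \<open>With equal heads the tails decide. The place where they differ is not z,
        because every exponent in the tails lies below z.\<close>
      have lift: "lex_less (coeff_of ((z, n) # us)) (coeff_of ((z, n) # vs))"
        if less: "lex_less (coeff_of us) (coeff_of vs)" and vs: "\<forall>p\<in>set vs. fst p \<in> elts z" for us vs
      proof -
        obtain t where t: "Ord t" "coeff_of us t < coeff_of vs t"
            "\<forall>y. t \<in> elts y \<longrightarrow> coeff_of us y = coeff_of vs y"
          using less unfolding lex_less_def by metis
        have "t \<noteq> z"
          using t(2) vs coeff_of_eq_0_above[of vs z z] z(1) by auto
        then show ?thesis
          unfolding lex_less_def using t by (intro exI[of _ t]) auto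
      qed
      show ?thesis
        using Cons.IH[of ys'] Cons.prems lift[of xs ys'] lift[of ys' xs] z y 3
        by (auto simp: Cons p q elts_oadd simp del: coeff_of_Cons)
    qed
  qed
qed

lemma lex_less_asym: "lex_less c d \<Longrightarrow> \<not> lex_less d c"
proof
  assume "lex_less c d" "lex_less d c"
  then obtain z y where z: "Ord z" "c z < d z" "\<forall>t. z \<in> elts t \<longrightarrow> c t = d t"
    and y: "Ord y" "d y < c y" "\<forall>t. y \<in> elts t \<longrightarrow> d t = c t"
    unfolding lex_less_def by blast
  show False
    using Ord_linear[OF z(1) y(1)] z(2,3) y(2,3) by auto
qed

lemma cnf_value_inj: "is_cnf xs \<Longrightarrow> is_cnf ys \<Longrightarrow> cnf_value xs = cnf_value ys \<Longrightarrow> xs = ys"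
  using cnf_cases_less[of xs ys] elem_irrefl by auto

definition osucc :: "'v::set_universe \<Rightarrow> 'v" where
  "osucc a = vset (insert a (elts a))"

lemma elts_osucc [simp]: "elts (osucc a) = insert a (elts a)"
  by (simp add: osucc_def elts_vset)

lemma Ord_osucc [simp]: "Ord a \<Longrightarrow> Ord (osucc a)"
  by (rule Ord_succ) simp_all

lemma cnf_ex1:
  assumes "Ord a"
  shows "\<exists>!xs. is_cnf xs \<and> cnf_value xs = a"
proof -
  have "a \<in> elts (omega_pow (osucc a))"
    using omega_pow_ge[of "osucc a"] assms by simp
  then obtain xs where "is_cnf xs" "cnf_value xs = a"
    using cnf_exists_below[of "osucc a" a] assms by auto
  then show ?thesis
    using cnf_value_inj by blast
qed

lemma is_cnf_cnf: "Ord a \<Longrightarrow> is_cnf (cnf a)"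
  and cnf_value_cnf: "Ord a \<Longrightarrow> cnf_value (cnf a) = a"
  using theI'[OF cnf_ex1[of a]] unfolding cnf_def by blast+

lemma cnf_cnf_value: "is_cnf xs \<Longrightarrow> cnf (cnf_value xs) = xs"
  by (rule cnf_value_inj) (auto simp: is_cnf_cnf cnf_value_cnf)

lemma cnf_coeff_eq: "cnf_coeff a = coeff_of (cnf a)"
  by (simp add: cnf_coeff_def coeff_of_def fun_eq_iff)

lemma oless_iff_lex_less:
  assumes "Ord a" "Ord b"
  shows "oless a b \<longleftrightarrow> lex_less (cnf_coeff a) (cnf_coeff b)"
  using cnf_cases_less[OF is_cnf_cnf[OF assms(1)] is_cnf_cnf[OF assms(2)]] assms
    elem_asym[of a b] elem_irrefl[of a] lex_less_asym[of "cnf_coeff a" "cnf_coeff b"] 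
    lex_less_asym[of "cnf_coeff a" "cnf_coeff a"]
  unfolding oless_def cnf_coeff_eq by (metis cnf_value_cnf)

lemma cnf_coeff_inj:
  assumes "Ord a" "Ord b" "cnf_coeff a = cnf_coeff b"
  shows "a = b"
  using oless_iff_lex_less[of a b] oless_iff_lex_less[of b a] oless_iff_lex_less[of a a]
    Ord_linear[of a b] assms elem_irrefl[of a] unfolding oless_def by auto

lemma cnf_coeff_support: "Ord a \<Longrightarrow> cnf_coeff a z \<noteq> 0 \<Longrightarrow> Ord z"
  using coeff_of_nonzero[of "cnf a" z] is_cnf_cnf[of a] by (auto simp: cnf_coeff_eq is_cnf_def)

lemma finite_cnf_coeff: "finite {z. cnf_coeff a z \<noteq> 0}"
  by (rule finite_subset[of _ "fst ` set (cnf a)"]) (use coeff_of_nonzero in \<open>auto simp: cnf_coeff_eq\<close>)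

text \<open>Turns a bound by a power into a condition on exponents alone, from which closure
  properties of powers can be read off.\<close>

lemma elem_omega_pow_iff_cnf:
  assumes "Ord a" "Ord b"
  shows "a \<in> elts (omega_pow b) \<longleftrightarrow> (\<forall>z. cnf_coeff a z \<noteq> 0 \<longrightarrow> z \<in> elts b)"
proof
  assume "a \<in> elts (omega_pow b)"
  then obtain xs where xs: "is_cnf xs" "\<forall>p\<in>set xs. fst p \<in> elts b" "cnf_value xs = a"
    using cnf_exists_below[OF assms(2), of a] by blast
  then have "cnf a = xs"
    using cnf_cnf_value by blast
  then show "\<forall>z. cnf_coeff a z \<noteq> 0 \<longrightarrow> z \<in> elts b"
    using xs(2) coeff_of_nonzero[of xs] by (auto simp: cnf_coeff_eq)
next
  assume *: "\<forall>z. cnf_coeff a z \<noteq> 0 \<longrightarrow> z \<in> elts b"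
  have "\<forall>p\<in>set (cnf a). fst p \<in> elts b"
  proof
    fix p assume p: "p \<in> set (cnf a)"
    have "\<exists>n. (fst p, n) \<in> set (cnf a)"
      using p by (intro exI[of _ "snd p"]) simp
    then obtain n where n: "map_of (cnf a) (fst p) = Some n"
      by (metis domD dom_map_of_conv_image_fst fst_conv image_eqI)
    then have "(fst p, n) \<in> set (cnf a)"
      by (rule map_of_SomeD)
    then have "n > 0"
      using is_cnf_cnf[OF assms(1)] by (auto simp: is_cnf_def)
    then have "cnf_coeff a (fst p) \<noteq> 0"
      using n by (simp add: cnf_coeff_def)
    then show "fst p \<in> elts b"
      using * by blast
  qed
  then show "a \<in> elts (omega_pow b)"
    using cnf_value_less[OF is_cnf_cnf[OF assms(1)]] cnf_value_cnf[OF assms(1)] by metis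
qed

section \<open>Monoid rings over a linearly ordered monoid\<close>

abbreviation keys :: "('a \<Rightarrow>\<^sub>0 'b::zero) \<Rightarrow> 'a set" where "keys \<equiv> Poly_Mapping.keys"
abbreviation lookup :: "('a \<Rightarrow>\<^sub>0 'b::zero) \<Rightarrow> 'a \<Rightarrow> 'b" where "lookup \<equiv> Poly_Mapping.lookup"
abbreviation single :: "'a \<Rightarrow> 'b::zero \<Rightarrow> 'a \<Rightarrow>\<^sub>0 'b" where "single \<equiv> Poly_Mapping.single"

lemma poly_mapping_sum_single: "f = (\<Sum>k\<in>keys f. single k (lookup f k))"
  by (rule poly_mapping_eqI)
    (simp add: lookup_sum lookup_single when_def in_keys_iff)

text \<open>The last case meets only exponents of the given f, so bounds on them remain usable
  although the induction runs through sums.\<close>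

lemma poly_mapping_single_induct [case_names zero add single]:
  assumes "P 0" "\<And>f g. P f \<Longrightarrow> P g \<Longrightarrow> P (f + g)" "\<And>m c. m \<in> keys f \<Longrightarrow> P (single m c)"
  shows "P (f :: 'a \<Rightarrow>\<^sub>0 'b::comm_monoid_add)"
proof -
  have "P (\<Sum>k\<in>K. single k (lookup f k))" if "finite K" "K \<subseteq> keys f" for K
    using that by (induction K rule: finite_induct) (auto intro: assms)
  from this[of "keys f"] show ?thesis
    by (simp flip: poly_mapping_sum_single)
qed

text \<open>The sum is brought into the shape of \<open>conv\<close>, so that
  \<open>conv_ext\<close> becomes a reindexing.\<close>

lemma lookup_times:
  fixes f g :: "'a::comm_monoid_add \<Rightarrow>\<^sub>0 'b::comm_semiring_1"
  shows "lookup (f * g) k = (\<Sum>(a, b) | a \<in> keys f \<and> b \<in> keys g \<and> a + b = k. lookup f a * lookup g b)"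
proof -
  have "f * g = (\<Sum>a\<in>keys f. \<Sum>b\<in>keys g. single (a + b) (lookup f a * lookup g b))"
    by (simp flip: mult_single sum_product poly_mapping_sum_single)
  then have "lookup (f * g) k = (\<Sum>a\<in>keys f. \<Sum>b\<in>keys g. (lookup f a * lookup g b when a + b = k))"
    by (simp add: lookup_sum lookup_single)
  also have "\<dots> = (\<Sum>(a, b)\<in>keys f \<times> keys g. (lookup f a * lookup g b when a + b = k))"
    by (rule sum.cartesian_product)
  also have "\<dots> = (\<Sum>(a, b) | a \<in> keys f \<and> b \<in> keys g \<and> a + b = k. lookup f a * lookup g b)"
    by (rule sum.mono_neutral_cong_right) auto
  finally show ?thesis .
qed

definition supported :: "'m set \<Rightarrow> ('m \<Rightarrow>\<^sub>0 'b::zero) set" where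
  "supported M = {f. keys f \<subseteq> M}"

lemma supported_zero [simp]: "0 \<in> supported M"
  by (simp add: supported_def)

lemma supported_one: "0 \<in> M \<Longrightarrow> (1 :: 'm::zero \<Rightarrow>\<^sub>0 'b::zero_neq_one) \<in> supported M"
  by (simp add: supported_def)

lemma supported_add: "f \<in> supported M \<Longrightarrow> g \<in> supported M \<Longrightarrow> f + g \<in> supported M"
  using keys_add[of f g] by (auto simp: supported_def)

lemma supported_uminus [simp]: "- f \<in> supported M \<longleftrightarrow> f \<in> supported M"
  for f :: "'m \<Rightarrow>\<^sub>0 'b::ab_group_add"
  by (auto simp: supported_def in_keys_iff subset_eq)

lemma supported_diff: "f \<in> supported M \<Longrightarrow> g \<in> supported M \<Longrightarrow> f - g \<in> supported M"
  for f :: "'m \<Rightarrow>\<^sub>0 'b::ab_group_add"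
  using supported_add[of f M "- g"] by simp

lemma supported_mult:
  "f \<in> supported M \<Longrightarrow> g \<in> supported N \<Longrightarrow> (\<And>a b. a \<in> M \<Longrightarrow> b \<in> N \<Longrightarrow> a + b \<in> L) \<Longrightarrow> f * g \<in> supported L"
  using keys_mult[of f g] by (auto simp: supported_def) blast

definition lead :: "('m::linorder \<Rightarrow>\<^sub>0 'b::zero) \<Rightarrow> 'm" where
  "lead f = Max (keys f)"

text \<open>For f = 0 the leading exponent is unspecified, yet the value is 0 whichever exponent is
  looked up.\<close>

definition lcoeff :: "('m::linorder \<Rightarrow>\<^sub>0 'b::zero) \<Rightarrow> 'b" where
  "lcoeff f = lookup f (lead f)"

lemma keys_nonempty: "f \<noteq> 0 \<Longrightarrow> keys f \<noteq> {}"
  using poly_mapping_eqI[of f 0] by (force simp: in_keys_iff)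

lemma lead_in_keys: "f \<noteq> 0 \<Longrightarrow> lead f \<in> keys f"
  unfolding lead_def by (intro Max_in keys_nonempty) auto

lemma lead_ge: "m \<in> keys f \<Longrightarrow> m \<le> lead f"
  unfolding lead_def by auto

lemma lcoeff_nonzero [simp]: "f \<noteq> 0 \<Longrightarrow> lcoeff f \<noteq> 0"
  using lead_in_keys[of f] by (simp add: lcoeff_def in_keys_iff)

lemma lcoeff_zero [simp]: "lcoeff 0 = 0"
  by (simp add: lcoeff_def)

lemma lead_unique: "m \<in> keys f \<Longrightarrow> (\<And>k. k \<in> keys f \<Longrightarrow> k \<le> m) \<Longrightarrow> lead f = m"
  unfolding lead_def by (intro Max_eqI) auto

text \<open>By strict monotonicity only the pair of leading exponents has sum
  \<open>lead f + lead g\<close>, so nothing can cancel at that place.\<close>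

lemma
  fixes f g :: "'m::{linorder,ordered_cancel_comm_monoid_add} \<Rightarrow>\<^sub>0 'b::idom"
  assumes "f \<noteq> 0" "g \<noteq> 0"
  shows lead_mult: "lead (f * g) = lead f + lead g"
    and lcoeff_mult: "lcoeff (f * g) = lcoeff f * lcoeff g"
proof -
  have "a = lead f \<and> b = lead g" if "a \<in> keys f" "b \<in> keys g" "a + b = lead f + lead g" for a b
    using that lead_ge[of a f] lead_ge[of b g] add_strict_mono[of a "lead f" b "lead g"]
      add_less_le_mono[of a "lead f" b "lead g"] add_le_less_mono[of a "lead f" b "lead g"]
    by (metis less_irrefl order_le_less)
  then have "{(a, b). a \<in> keys f \<and> b \<in> keys g \<and> a + b = lead f + lead g} = {(lead f, lead g)}"
    using assms lead_in_keys by auto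
  then have *: "lookup (f * g) (lead f + lead g) = lcoeff f * lcoeff g"
    by (simp add: lookup_times lcoeff_def)
  show "lead (f * g) = lead f + lead g"
  proof (rule lead_unique)
    show "lead f + lead g \<in> keys (f * g)"
      using * assms by (simp add: in_keys_iff)
    show "k \<le> lead f + lead g" if "k \<in> keys (f * g)" for k
      using that keys_mult[of f g] lead_ge[of _ f] lead_ge[of _ g] by (auto intro: add_mono)
  qed
  with * show "lcoeff (f * g) = lcoeff f * lcoeff g"
    by (simp add: lcoeff_def)
qed

section \<open>Unique factorisation\<close>

text \<open>
  \<open>e m i\<close> is the multiplicity of the variable \<open>i\<close> in the monomial \<open>m\<close>, so the monoid ring over
  \<open>'m\<close> is a polynomial ring with variables indexed by \<open>'i\<close>.
\<close>

locale free_exponents =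
  fixes e :: "'m::{linorder,ordered_cancel_comm_monoid_add} \<Rightarrow> 'i \<Rightarrow> nat" and gen :: "'i \<Rightarrow> 'm"
  assumes e_zero [simp]: "e 0 i = 0"
    and e_add [simp]: "e (m + n) i = e m i + e n i"
    and e_gen [simp]: "e (gen i) j = (if i = j then 1 else 0)"
    and e_split: "0 < e m i \<Longrightarrow> \<exists>n. m = gen i + n"
    and e_inj: "(\<And>i. e m i = e n i) \<Longrightarrow> m = n"
    and e_finite: "finite {i. e m i \<noteq> 0}"
    and zero_le: "0 \<le> m"
begin

section \<open>Degrees in a single variable\<close>

definition X :: "'i \<Rightarrow> 'm \<Rightarrow>\<^sub>0 int" where
  "X i = single (gen i) 1"

text \<open>Degree less than \<open>n\<close> in the variable \<open>i\<close>; the zero polynomial is the only one with \<open>n = 0\<close>.\<close>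

definition low :: "'i \<Rightarrow> nat \<Rightarrow> ('m \<Rightarrow>\<^sub>0 int) set" where
  "low i n = supported {m. e m i < n}"

definition poly_in :: "'i set \<Rightarrow> ('m \<Rightarrow>\<^sub>0 int) set" where
  "poly_in S = supported {m. \<forall>i. e m i \<noteq> 0 \<longrightarrow> i \<in> S}"

lemma X_nonzero [simp]: "X i \<noteq> 0"
  unfolding X_def by (metis lookup_single_eq lookup_zero zero_neq_one)

lemma low_zero [simp]: "0 \<in> low i n"
  and low_add: "f \<in> low i n \<Longrightarrow> g \<in> low i n \<Longrightarrow> f + g \<in> low i n"
  and low_diff: "f \<in> low i n \<Longrightarrow> g \<in> low i n \<Longrightarrow> f - g \<in> low i n"
  and low_uminus: "- f \<in> low i n \<longleftrightarrow> f \<in> low i n"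
  by (simp_all add: low_def supported_add supported_diff)

lemma low_mono: "f \<in> low i n \<Longrightarrow> n \<le> k \<Longrightarrow> f \<in> low i k"
  by (auto simp: low_def supported_def)

lemma low_0 [simp]: "f \<in> low i 0 \<longleftrightarrow> f = 0"
  using keys_nonempty[of f] by (auto simp: low_def supported_def)

lemma low_one [simp]: "1 \<in> low i (Suc n)"
  by (simp add: low_def supported_def)

text \<open>Degree at most a times degree below b is degree below a + b. The \<open>Suc\<close> on
  one side avoids truncated subtraction, and b = 0 remains meaningful.\<close>

lemma low_mult: "f \<in> low i (Suc a) \<Longrightarrow> g \<in> low i b \<Longrightarrow> f * g \<in> low i (a + b)"
  unfolding low_def by (erule supported_mult) auto

lemma low_mult': "f \<in> low i a \<Longrightarrow> g \<in> low i (Suc b) \<Longrightarrow> f * g \<in> low i (a + b)"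
  unfolding low_def by (erule supported_mult) auto

lemma low_X_power [simp]: "X i ^ k \<in> low i (Suc k)"
proof (induction k)
  case (Suc k)
  have "X i \<in> low i (Suc 1)"
    by (simp add: X_def low_def supported_def)
  from low_mult[OF this Suc] show ?case by simp
qed simp

lemma low_exists: "\<exists>n. f \<in> low i n"
proof
  show "f \<in> low i (Suc (Max ((\<lambda>m. e m i) ` keys f)))"
    by (auto simp: low_def supported_def less_Suc_eq_le)
qed

lemma poly_in_zero [simp]: "0 \<in> poly_in S"
  and poly_in_one [simp]: "1 \<in> poly_in S"
  and poly_in_add: "f \<in> poly_in S \<Longrightarrow> g \<in> poly_in S \<Longrightarrow> f + g \<in> poly_in S"
  and poly_in_diff: "f \<in> poly_in S \<Longrightarrow> g \<in> poly_in S \<Longrightarrow> f - g \<in> poly_in S"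
  by (simp_all add: poly_in_def supported_add supported_diff supported_one)

lemma poly_in_mult: "f \<in> poly_in S \<Longrightarrow> g \<in> poly_in S \<Longrightarrow> f * g \<in> poly_in S"
  unfolding poly_in_def by (erule supported_mult) auto

lemma poly_in_X: "i \<in> S \<Longrightarrow> X i \<in> poly_in S"
  by (simp add: X_def poly_in_def supported_def)

lemma poly_in_power: "f \<in> poly_in S \<Longrightarrow> f ^ k \<in> poly_in S"
  by (induction k) (auto intro: poly_in_mult)

lemma poly_in_mono: "f \<in> poly_in S \<Longrightarrow> S \<subseteq> T \<Longrightarrow> f \<in> poly_in T"
  by (auto simp: poly_in_def supported_def)

text \<open>Reduces questions about a set of variables to one excluded variable at a time.\<close>

lemma poly_in_iff_low: "f \<in> poly_in S \<longleftrightarrow> (\<forall>i. i \<notin> S \<longrightarrow> f \<in> low i 1)"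
  by (fastforce simp: poly_in_def low_def supported_def)

lemma poly_in_insert_low: "f \<in> poly_in (insert i S) \<Longrightarrow> f \<in> low i 1 \<Longrightarrow> f \<in> poly_in S"
  unfolding poly_in_iff_low by (metis insert_iff)

text \<open>All monomials of the product have exponent exactly k in i, so a nonzero product cannot
  have degree below k. This compares top coefficients without extracting them.\<close>

lemma X_power_mult_low:
  assumes "f \<in> low i 1" "X i ^ k * f \<in> low i k"
  shows "f = 0"
proof (rule ccontr)
  assume f: "f \<noteq> 0"
  have "X i ^ k * f \<in> supported {m. e m i = k}"
  proof (induction k)
    case 0
    show ?case
      using assms(1) by (simp add: low_def)
  next
    case (Suc k)
    have "X i \<in> supported {m. e m i = 1}"
      by (simp add: X_def supported_def)
    from supported_mult[OF this Suc, of "{m. e m i = Suc k}"] show ?case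
      by (simp add: mult.assoc)
  qed
  moreover have "keys (X i ^ k * f) \<noteq> {}"
    using f by (intro keys_nonempty) simp
  then obtain m where "m \<in> keys (X i ^ k * f)"
    by blast
  ultimately show False
    using assms(2) by (auto simp: low_def supported_def)
qed

lemma monom_decompose:
  "\<exists>n. single m c = X i ^ e m i * single n c \<and> e n i = 0 \<and> (\<forall>j. e n j \<le> e m j)"
proof (induction "e m i" arbitrary: m)
  case 0
  then show ?case by (metis mult_1 order_refl power_0)
next
  case (Suc k)
  then obtain m' where m: "m = gen i + m'"
    using e_split[of m i] by auto
  then have "k = e m' i"
    using Suc.hyps(2) by simp
  then obtain n where n: "single m' c = X i ^ k * single n c" "e n i = 0" "\<forall>j. e n j \<le> e m' j"
    using Suc.hyps(1) by metis
  have "single m c = X i * single m' c"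
    by (simp add: X_def mult_single m)
  then have "single m c = X i ^ e m i * single n c"
    using n(1) Suc.hyps(2) by (metis mult.assoc power_Suc)
  then show ?case
    using n(2,3) m by (intro exI[of _ n]) (auto simp: trans_le_add2)
qed

text \<open>f is read as a polynomial in \<open>X i\<close>: f0 is the coefficient of
  \<open>X i ^ k\<close>, possibly 0, and f1 collects the lower degrees.\<close>

lemma low_decompose:
  assumes "f \<in> low i (Suc k)" "f \<in> poly_in S"
  shows "\<exists>f0 f1. f = X i ^ k * f0 + f1 \<and> f0 \<in> low i 1 \<and> f1 \<in> low i k \<and> f0 \<in> poly_in S \<and> f1 \<in> poly_in S"
    (is "?P f")
proof (induction f rule: poly_mapping_single_induct)
  case zero
  then show ?case by (intro exI[of _ 0]) simp
next
  case (add f g)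
  then obtain f0 f1 g0 g1 where
    "f = X i ^ k * f0 + f1 \<and> f0 \<in> low i 1 \<and> f1 \<in> low i k \<and> f0 \<in> poly_in S \<and> f1 \<in> poly_in S"
    "g = X i ^ k * g0 + g1 \<and> g0 \<in> low i 1 \<and> g1 \<in> low i k \<and> g0 \<in> poly_in S \<and> g1 \<in> poly_in S"
    by blast
  then show ?case
    by (intro exI[of _ "f0 + g0"] exI[of _ "f1 + g1"]) (auto simp: algebra_simps low_add poly_in_add)
next
  case (single m c)
  then have m: "e m i \<le> k" "\<forall>i. e m i \<noteq> 0 \<longrightarrow> i \<in> S"
    using assms by (auto simp: low_def poly_in_def supported_def)
  show ?case
  proof (cases "e m i = k")
    case True
    obtain n where n: "single m c = X i ^ k * single n c" "e n i = 0" "\<forall>j. e n j \<le> e m j"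
      using monom_decompose[of m c i] True by auto
    then have "\<forall>j. e n j \<noteq> 0 \<longrightarrow> j \<in> S"
      using m(2) by (metis le_zero_eq)
    with n show ?thesis
      by (intro exI[of _ "single n c"] exI[of _ 0]) (auto simp: low_def poly_in_def supported_def)
  next
    case False
    with m show ?thesis
      by (intro exI[of _ 0] exI[of _ "single m c"]) (auto simp: low_def poly_in_def supported_def)
  qed
qed

lemma lead_decompose:
  assumes "f \<noteq> 0"
  shows "\<exists>k f0 f1. f = X i ^ k * f0 + f1 \<and> f0 \<noteq> 0 \<and> f0 \<in> low i 1 \<and> f1 \<in> low i k \<and> f \<in> low i (Suc k) \<and> f \<notin> low i k"
proof -
  define n where "n = (LEAST n. f \<in> low i n)"
  have n: "f \<in> low i n"
    unfolding n_def using low_exists by (rule LeastI_ex)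
  then obtain k where k: "n = Suc k"
    using assms by (cases n) auto
  have nk: "f \<notin> low i k"
    using not_less_Least[of k "\<lambda>n. f \<in> low i n"] k n_def by simp
  obtain f0 f1 where f: "f = X i ^ k * f0 + f1" "f0 \<in> low i 1" "f1 \<in> low i k"
    using low_decompose[of f i k UNIV] n k by (auto simp: poly_in_iff_low)
  then have "f0 \<noteq> 0"
    using nk by auto
  with f nk n k show ?thesis by blast
qed

text \<open>Degrees add because the top coefficients f0 and g0 have a nonzero product. If f had
  degree a with n <= a, removing the lower terms from f * g would leave
  \<open>X i ^ (a + b) * (f0 * g0)\<close> with degree below a + b, forcing it to vanish.\<close>

lemma low_divisor:
  assumes "f * g \<in> low i n" "f * g \<noteq> 0"
  shows "f \<in> low i n"
proof -
  obtain a f0 f1 where f: "f = X i ^ a * f0 + f1" "f0 \<noteq> 0" "f0 \<in> low i 1" "f1 \<in> low i a" "f \<in> low i (Suc a)"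
    using lead_decompose[of f i] assms(2) by auto
  obtain b g0 g1 where g: "g = X i ^ b * g0 + g1" "g0 \<noteq> 0" "g0 \<in> low i 1" "g1 \<in> low i b" "g \<in> low i (Suc b)"
    using lead_decompose[of g i] assms(2) by auto
  show ?thesis
  proof (rule ccontr)
    assume "f \<notin> low i n"
    then have "n \<le> a"
      using f(5) low_mono by (metis not_less_eq_eq)
    then have "f * g \<in> low i (a + b)"
      using assms(1) low_mono trans_le_add1 by blast
    moreover have "f1 * g \<in> low i (a + b)"
      using f(4) g(5) by (rule low_mult')
    moreover have "X i ^ a * f0 * g1 \<in> low i (a + b)"
      using low_mult[OF _ g(4), of "X i ^ a * f0" a] low_mult[OF low_X_power f(3)[simplified], of a] by simp
    ultimately have "f * g - f1 * g - X i ^ a * f0 * g1 \<in> low i (a + b)"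
      by (intro low_diff)
    moreover have "f * g - f1 * g - X i ^ a * f0 * g1 = X i ^ (a + b) * (f0 * g0)"
      by (simp add: f(1) g(1) algebra_simps power_add)
    moreover have "f0 * g0 \<in> low i 1"
      using low_mult[of f0 i 0 g0 1] f(3) g(3) by simp
    ultimately have "f0 * g0 = 0"
      using X_power_mult_low by metis
    with f(2) g(2) show False by simp
  qed
qed

section \<open>Division and divisibility relative to a set of variables\<close>

lemma poly_in_divisor: "f * g \<in> poly_in S \<Longrightarrow> f * g \<noteq> 0 \<Longrightarrow> f \<in> poly_in S"
  using low_divisor[of f g] by (auto simp: poly_in_iff_low)

lemma poly_in_divisor': "f * g \<in> poly_in S \<Longrightarrow> f * g \<noteq> 0 \<Longrightarrow> g \<in> poly_in S"
  using poly_in_divisor[of g f] by (simp add: mult.commute)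

text \<open>This is division with remainder in \<open>X i\<close> over a coefficient field, with
  denominators cleared: each reduction multiplies by the top coefficient h0, and c accumulates these
  factors, none of which involves i.\<close>

lemma pseudo_division:
  assumes h: "h = X i ^ d * h0 + h1" "h0 \<noteq> 0" "h0 \<in> low i 1" "h1 \<in> low i d" "h0 \<in> poly_in T" "h1 \<in> poly_in T"
    and i: "i \<in> T"
  shows "f \<in> low i n \<Longrightarrow> f \<in> poly_in T \<Longrightarrow>
    \<exists>c q r. c \<noteq> 0 \<and> c \<in> low i 1 \<and> c \<in> poly_in T \<and> q \<in> poly_in T \<and> r \<in> poly_in T \<and> r \<in> low i d \<and> c * f = q * h + r"
proof (induction n arbitrary: f)
  case 0
  then show ?case
    by (intro exI[of _ 1] exI[of _ 0]) simp
next
  case (Suc n)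
  show ?case
  proof (cases "Suc n \<le> d")
    case True
    then show ?thesis
      using Suc.prems low_mono by (intro exI[of _ 1] exI[of _ 0] exI[of _ f]) auto
  next
    case False
    then have dn: "d \<le> n" by simp
    obtain f0 f1 where f: "f = X i ^ n * f0 + f1" "f0 \<in> low i 1" "f1 \<in> low i n" "f0 \<in> poly_in T" "f1 \<in> poly_in T"
      using low_decompose[OF Suc.prems] by blast
    \<comment> \<open>The terms \<open>X i ^ n * h0 * f0\<close> of the two products cancel, which
      lowers the degree bound.\<close>
    define g where "g = h0 * f - X i ^ (n - d) * f0 * h"
    have "X i ^ n = X i ^ (n - d) * X i ^ d"
      using dn by (simp flip: power_add)
    then have g: "g = h0 * f1 - X i ^ (n - d) * f0 * h1"
      by (simp add: g_def f(1) h(1) algebra_simps)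
    have "h0 * f1 \<in> low i n"
      using low_mult[of h0 i 0 f1 n] h(3) f(3) by simp
    moreover have "X i ^ (n - d) * f0 * h1 \<in> low i n"
      using low_mult[OF _ h(4), of "X i ^ (n - d) * f0" "n - d"] low_mult[OF low_X_power f(2), of "n - d"] dn by simp
    ultimately have "g \<in> low i n"
      unfolding g by (rule low_diff)
    moreover have X: "X i ^ (n - d) * f0 \<in> poly_in T"
      using i f(4) by (intro poly_in_mult poly_in_power poly_in_X)
    have "g \<in> poly_in T"
      unfolding g using h(5,6) f(5) by (intro poly_in_diff poly_in_mult[OF X] poly_in_mult)
    ultimately obtain c q r where *: "c \<noteq> 0" "c \<in> low i 1" "c \<in> poly_in T" "q \<in> poly_in T" "r \<in> poly_in T"
        "r \<in> low i d" "c * g = q * h + r"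
      using Suc.IH by metis
    have "c * h0 * f = (q + c * (X i ^ (n - d) * f0)) * h + r"
      using *(7) by (simp add: g_def algebra_simps)
    moreover have "c * h0 \<in> low i 1"
      using low_mult[of c i 0 h0 1] h(3) *(2) by simp
    moreover have "q + c * (X i ^ (n - d) * f0) \<in> poly_in T"
      using *(3,4) by (intro poly_in_add poly_in_mult[OF _ X])
    moreover have "c * h0 \<in> poly_in T"
      using h * by (intro poly_in_mult)
    ultimately show ?thesis
      using * h(2) by (intro exI[of _ "c * h0"] exI[of _ "q + c * (X i ^ (n - d) * f0)"] exI[of _ r]) simp
  qed
qed

text \<open>The quotient h has degree at most k, and comparing the terms of degree k gives f0 = p *
  h0. The zero polynomial is separate because \<open>low_divisor\<close> needs a nonzero
  product.\<close>

lemma low_dvd_parts: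
  assumes p: "p \<in> low i 1" and f: "f0 \<in> low i 1" "f1 \<in> low i k" and "p dvd X i ^ k * f0 + f1"
  shows "p dvd f0"
proof (cases "X i ^ k * f0 + f1 = 0")
  case True
  then have "X i ^ k * f0 \<in> low i k"
    using f(2) low_uminus by (metis add_eq_0_iff2)
  then show ?thesis
    using X_power_mult_low f(1) by blast
next
  case False
  obtain h where h: "X i ^ k * f0 + f1 = p * h"
    using assms(4) by blast
  have "X i ^ k * f0 + f1 \<in> low i (Suc k)"
    using low_mult[OF low_X_power f(1), of k] f(2) low_mono[of f1 i k "Suc k"] by (auto intro: low_add)
  then have "h \<in> low i (Suc k)"
    using low_divisor[of h p] h False by (simp add: mult.commute)
  then obtain h0 h1 where h': "h = X i ^ k * h0 + h1" "h0 \<in> low i 1" "h1 \<in> low i k"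
    using low_decompose[of h i k UNIV] by (auto simp: poly_in_iff_low)
  have "X i ^ k * (f0 - p * h0) = p * h1 - f1"
    using h h'(1) by (simp add: algebra_simps)
  moreover have "p * h1 - f1 \<in> low i k"
    using low_mult[of p i 0 h1 k] p h'(3) f(2) by (simp add: low_diff)
  moreover have "f0 - p * h0 \<in> low i 1"
    using low_mult[of p i 0 h0 1] p h'(2) f(1) by (simp add: low_diff)
  ultimately have "f0 - p * h0 = 0"
    using X_power_mult_low by metis
  then show ?thesis by simp
qed

text \<open>Gauss's argument: p divides the top coefficient f0 * g0, hence f0 or g0, and removing
  the corresponding top term lowers one of the degree bounds a, b. The bounds need not be exact, so
  vanishing top coefficients do no harm.\<close>

lemma prime_extends:
  assumes prime: "\<And>f g. f \<in> poly_in S \<Longrightarrow> g \<in> poly_in S \<Longrightarrow> p dvd f * g \<Longrightarrow> p dvd f \<or> p dvd g"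
    and p: "p \<in> poly_in S" and i: "i \<notin> S"
    and f: "f \<in> poly_in (insert i S)" and g: "g \<in> poly_in (insert i S)" and dvd: "p dvd f * g"
  shows "p dvd f \<or> p dvd g"
proof -
  have p1: "p \<in> low i 1"
    using p i by (simp add: poly_in_iff_low)
  have "f \<in> low i a \<Longrightarrow> g \<in> low i b \<Longrightarrow> ?thesis" for a b
    using f g dvd
  proof (induction "a + b" arbitrary: a b f g rule: less_induct)
    case less
    show ?case
    proof (cases "a = 0 \<or> b = 0")
      case True
      then show ?thesis using less.prems by auto
    next
      case False
      then obtain a' b' where ab: "a = Suc a'" "b = Suc b'"
        by (meson not0_implies_Suc)
      obtain f0 f1 where f: "f = X i ^ a' * f0 + f1" "f0 \<in> low i 1" "f1 \<in> low i a'"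
          "f0 \<in> poly_in (insert i S)" "f1 \<in> poly_in (insert i S)"
        using low_decompose less.prems ab by metis
      obtain g0 g1 where g: "g = X i ^ b' * g0 + g1" "g0 \<in> low i 1" "g1 \<in> low i b'"
          "g0 \<in> poly_in (insert i S)" "g1 \<in> poly_in (insert i S)"
        using low_decompose less.prems ab by metis
      have fg: "f * g = X i ^ (a' + b') * (f0 * g0) + (X i ^ a' * f0 * g1 + f1 * g)"
        by (simp add: f(1) g(1) algebra_simps power_add)
      have "f1 * g \<in> low i (a' + b')"
        using f(3) less.prems(2) ab by (auto intro: low_mult')
      moreover have "X i ^ a' * f0 * g1 \<in> low i (a' + b')"
        using low_mult[OF _ g(3), of "X i ^ a' * f0" a'] low_mult[OF low_X_power f(2), of a'] by simp
      ultimately have "X i ^ a' * f0 * g1 + f1 * g \<in> low i (a' + b')"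
        by (rule low_add[rotated])
      moreover have "f0 * g0 \<in> low i 1"
        using low_mult[of f0 i 0 g0 1] f(2) g(2) by simp
      ultimately have "p dvd f0 * g0"
        using low_dvd_parts[OF p1] less.prems(5) fg by metis
      then have "p dvd f0 \<or> p dvd g0"
        using f g by (intro prime) (auto intro: poly_in_insert_low)
      then show ?thesis
      proof
        assume p0: "p dvd f0"
        then have "p dvd f * g - X i ^ a' * f0 * g"
          using less.prems(5) by (intro dvd_diff) auto
        then have "p dvd f1 * g"
          by (simp add: f(1) algebra_simps)
        then have "p dvd f1 \<or> p dvd g"
          using less.hyps[of a' b f1 g] f g ab less.prems by auto
        then show ?thesis
          using p0 f(1) by auto
      next
        assume p0: "p dvd g0"
        then have "p dvd f * g - X i ^ b' * g0 * f"
          using less.prems(5) by (intro dvd_diff) auto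
        then have "p dvd f * g1"
          by (simp add: g(1) algebra_simps)
        then have "p dvd f \<or> p dvd g1"
          using less.hyps[of a b' f g1] f g ab less.prems by auto
        then show ?thesis
          using p0 g(1) by auto
      qed
    qed
  qed
  then show ?thesis
    using low_exists by blast
qed

lemma unit_times_dvd: "u dvd 1 \<Longrightarrow> p dvd u * f \<Longrightarrow> p dvd f"
  for u :: "'m \<Rightarrow>\<^sub>0 int"
proof -
  assume "u dvd 1" and p: "p dvd u * f"
  then obtain w where "1 = u * w" by blast
  then have "f = w * (u * f)"
    by (metis mult.assoc mult.commute mult_1)
  with p show "p dvd f"
    by (metis dvd_mult)
qed

section \<open>The size of a polynomial and the existence of factorisations\<close>

definition tdeg :: "'m \<Rightarrow> nat" where
  "tdeg m = (\<Sum>i | e m i \<noteq> 0. e m i)"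

lemma tdeg_superset: "finite I \<Longrightarrow> {i. e m i \<noteq> 0} \<subseteq> I \<Longrightarrow> tdeg m = (\<Sum>i\<in>I. e m i)"
  unfolding tdeg_def by (rule sum.mono_neutral_left) auto

lemma tdeg_add: "tdeg (m + n) = tdeg m + tdeg n"
proof -
  let ?I = "{i. e m i \<noteq> 0} \<union> {i. e n i \<noteq> 0}"
  have fin: "finite ?I"
    by (intro finite_UnI e_finite)
  have "tdeg (m + n) = (\<Sum>i\<in>?I. e (m + n) i)"
    by (rule tdeg_superset[OF fin]) auto
  moreover have "tdeg m = (\<Sum>i\<in>?I. e m i)"
    by (rule tdeg_superset[OF fin]) auto
  moreover have "tdeg n = (\<Sum>i\<in>?I. e n i)"
    by (rule tdeg_superset[OF fin]) auto
  ultimately show ?thesis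
    by (simp add: sum.distrib)
qed

lemma tdeg_eq_0: "tdeg m = 0 \<Longrightarrow> m = 0"
  using e_finite[of m] by (intro e_inj) (auto simp: tdeg_def)

text \<open>Strictly decreases when passing to a proper divisor, which yields atomicity.\<close>

definition msize :: "('m \<Rightarrow>\<^sub>0 int) \<Rightarrow> nat" where
  "msize f = tdeg (lead f) + nat \<bar>lcoeff f\<bar>"

lemma constant_iff: "keys f \<subseteq> {0} \<longleftrightarrow> f = of_int (lookup f 0)"
  for f :: "'m \<Rightarrow>\<^sub>0 int"
proof
  assume "keys f \<subseteq> {0}"
  then show "f = of_int (lookup f 0)"
    by (intro poly_mapping_eqI) (auto simp: lookup_of_int when_def in_keys_iff)
next
  assume *: "f = of_int (lookup f 0)"
  have "lookup f m = 0" if "m \<noteq> 0" for m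
    using arg_cong[OF *, of "\<lambda>h. lookup h m"] that by (simp add: lookup_of_int)
  then show "keys f \<subseteq> {0}"
    by (auto simp: in_keys_iff)
qed

lemma poly_in_empty_iff: "f \<in> poly_in {} \<longleftrightarrow> f = of_int (lookup f 0)"
proof -
  have "(\<forall>i. e m i = 0) \<longleftrightarrow> m = 0" for m
    using e_inj[of m 0] by auto
  then show ?thesis
    unfolding constant_iff[symmetric] by (simp add: poly_in_def supported_def subset_eq)
qed

text \<open>If \<open>lead g\<close> is nonzero, the total degree grows. Otherwise g is constant,
  since 0 is the least exponent, and a non-unit integer other than 0 has absolute value at least
  2.\<close>

lemma msize_less:
  assumes "f \<noteq> 0" "g \<noteq> 0" "\<not> g dvd 1"
  shows "msize f < msize (f * g)"
proof -
  have eq: "msize (f * g) = tdeg (lead f) + tdeg (lead g) + nat \<bar>lcoeff f\<bar> * nat \<bar>lcoeff g\<bar>"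
    using assms by (simp add: msize_def lead_mult lcoeff_mult tdeg_add abs_mult nat_mult_distrib)
  have pos: "0 < nat \<bar>lcoeff f\<bar>" "0 < nat \<bar>lcoeff g\<bar>"
    using assms by auto
  show ?thesis
  proof (cases "tdeg (lead g) = 0")
    case False
    have "nat \<bar>lcoeff f\<bar> \<le> nat \<bar>lcoeff f\<bar> * nat \<bar>lcoeff g\<bar>"
      using mult_le_mono2[of 1 "nat \<bar>lcoeff g\<bar>" "nat \<bar>lcoeff f\<bar>"] pos by linarith
    then show ?thesis
      using False unfolding eq unfolding msize_def by linarith
  next
    case True
    then have lead: "lead g = 0"
      by (rule tdeg_eq_0)
    then have "keys g \<subseteq> {0}"
      using lead_ge[of _ g] zero_le by (auto intro: antisym)
    then have g: "g = of_int (lcoeff g)"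
      using lead by (simp add: constant_iff lcoeff_def)
    have "nat \<bar>lcoeff g\<bar> \<noteq> 1"
    proof
      assume "nat \<bar>lcoeff g\<bar> = 1"
      then have "lcoeff g = 1 \<or> lcoeff g = - 1"
        by linarith
      then have "g = 1 \<or> g = - 1"
        using g by auto
      then show False
        using assms(3) by auto
    qed
    with pos have "1 < nat \<bar>lcoeff g\<bar>"
      by linarith
    then have "nat \<bar>lcoeff f\<bar> < nat \<bar>lcoeff f\<bar> * nat \<bar>lcoeff g\<bar>"
      using mult_strict_left_mono[of 1 "nat \<bar>lcoeff g\<bar>" "nat \<bar>lcoeff f\<bar>"] pos by linarith
    then show ?thesis
      unfolding eq unfolding msize_def by linarith
  qed
qed

lemma irreducible_factor:
  fixes f :: "'m \<Rightarrow>\<^sub>0 int"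
  shows "f \<noteq> 0 \<Longrightarrow> \<not> f dvd 1 \<Longrightarrow> \<exists>p h. irreducible p \<and> f = p * h"
proof (induction f rule: measure_induct_rule[of msize])
  case (less f)
  show ?case
  proof (cases "irreducible f")
    case True
    then show ?thesis by (metis mult_1_right)
  next
    case False
    then obtain a b where ab: "f = a * b" "\<not> a dvd 1" "\<not> b dvd 1"
      using less.prems by (auto simp: irreducible_def)
    then have "msize a < msize f"
      using less.prems msize_less[of a b] by auto
    then obtain p h where "irreducible p" "a = p * h"
      using less.IH[of a] less.prems ab by auto
    then show ?thesis
      using ab(1) by (metis mult.assoc)
  qed
qed

text \<open>Existence of factorisations in the form of an induction rule. It is available before
  irreducibles are known to be prime, and the proof of that fact relies on it.\<close>

lemma factor_induct [consumes 1, case_names unit irreducible]: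
  fixes c :: "'m \<Rightarrow>\<^sub>0 int"
  assumes "c \<noteq> 0" "\<And>u. u dvd 1 \<Longrightarrow> P u"
    and "\<And>p c. irreducible p \<Longrightarrow> c \<noteq> 0 \<Longrightarrow> P c \<Longrightarrow> P (p * c)"
  shows "P c"
  using assms(1)
proof (induction c rule: measure_induct_rule[of msize])
  case (less c)
  show ?case
  proof (cases "c dvd 1")
    case False
    then obtain p h where ph: "irreducible p" "c = p * h"
      using irreducible_factor less.prems by blast
    then have "msize h < msize c"
      using msize_less[of h p] less.prems by (auto simp: mult.commute irreducible_def)
    then show ?thesis
      using less.IH[of h] less.prems ph assms(3) by auto
  qed (rule assms(2))
qed

text \<open>Irreducibility and divisibility refer to the full ring. They agree with the notions
  inside \<open>poly_in S\<close>, because factors of a nonzero element of \<open>poly_in S\<close>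
  lie there again.\<close>

definition primes_in :: "'i set \<Rightarrow> bool" where
  "primes_in S \<longleftrightarrow> (\<forall>p f g. irreducible p \<longrightarrow> p \<in> poly_in S \<longrightarrow> f \<in> poly_in S \<longrightarrow> g \<in> poly_in S \<longrightarrow>
     p dvd f * g \<longrightarrow> p dvd f \<or> p dvd g)"

text \<open>Without variables only a copy of the integers remains, where irreducibles are prime.
  Divisibility transfers because a quotient of nonzero constants is constant.\<close>

lemma primes_in_empty: "primes_in {}"
  unfolding primes_in_def
proof (intro allI impI)
  fix p f g
  assume p: "irreducible p" "p \<in> poly_in {}" and f: "f \<in> poly_in {}" and g: "g \<in> poly_in {}"
    and dvd: "p dvd f * g"
  obtain c a b where cab: "p = of_int c" "f = of_int a" "g = of_int b"
    using p(2) f g unfolding poly_in_empty_iff by blast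
  have dvd_iff: "(of_int x :: 'm \<Rightarrow>\<^sub>0 int) dvd of_int y \<longleftrightarrow> x dvd y" for x y
  proof
    assume *: "(of_int x :: 'm \<Rightarrow>\<^sub>0 int) dvd of_int y"
    show "x dvd y"
    proof (cases "y = 0")
      case False
      obtain h :: "'m \<Rightarrow>\<^sub>0 int" where h: "of_int y = of_int x * h"
        using * by blast
      have "(of_int y :: 'm \<Rightarrow>\<^sub>0 int) \<in> poly_in {}"
        by (simp add: poly_in_empty_iff lookup_of_int)
      then have "h \<in> poly_in {}"
        using poly_in_divisor'[of "of_int x" h "{}"] h False by (metis of_int_eq_0_iff)
      then obtain z where "h = of_int z"
        unfolding poly_in_empty_iff by blast
      then have "(of_int y :: 'm \<Rightarrow>\<^sub>0 int) = of_int (x * z)"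
        using h by simp
      then show ?thesis
        unfolding of_int_eq_iff by simp
    qed simp
  next
    assume "x dvd y"
    then show "(of_int x :: 'm \<Rightarrow>\<^sub>0 int) dvd of_int y"
      by (metis dvd_def of_int_mult)
  qed
  have "irreducible c"
    unfolding irreducible_def
  proof (intro conjI allI impI)
    show "c \<noteq> 0" "\<not> c dvd 1"
      using p(1) cab(1) dvd_iff[of c 1] by (auto simp: irreducible_def)
    fix x y assume "c = x * y"
    then have "p = of_int x * of_int y"
      using cab(1) by simp
    then show "x dvd 1 \<or> y dvd 1"
      using p(1) dvd_iff[of x 1] dvd_iff[of y 1] by (auto simp: irreducible_def)
  qed
  then have "prime_elem c"
    using irreducible_imp_prime_elem_gcd by blast
  moreover have "c dvd a * b"
    using dvd dvd_iff[of c "a * b"] cab by simp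
  ultimately show "p dvd f \<or> p dvd g"
    using cab dvd_iff by (auto simp: prime_elem_dvd_mult_iff)
qed

text \<open>
  Let \<open>p\<close> involve the new variable and divide \<open>f * g\<close> but not \<open>g\<close>. Pseudo-division shows that every
  element of the ideal \<open>J\<close> of all \<open>h\<close> with \<open>p dvd h * g\<close> becomes, after multiplication by a nonzero
  polynomial without the new variable, a multiple of an element \<open>h\<close> of \<open>J\<close> of least degree. The
  prime factors of such multipliers lie in \<open>poly_in S\<close> and do not divide \<open>p\<close>, so they cancel.
\<close>

lemma primes_in_insert:
  assumes "primes_in S" "i \<notin> S"
  shows "primes_in (insert i S)"
  unfolding primes_in_def
proof (intro allI impI)
  let ?T = "insert i S"
  fix p f g
  assume p: "irreducible p" and pT: "p \<in> poly_in ?T" and f: "f \<in> poly_in ?T" and g: "g \<in> poly_in ?T"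
    and dvd: "p dvd f * g"
  have old: "q dvd u \<or> q dvd v"
    if "irreducible q" "q \<in> poly_in S" "u \<in> poly_in ?T" "v \<in> poly_in ?T" "q dvd u * v" for q u v
    using prime_extends[of S q i u v] that assms unfolding primes_in_def by blast
  have p0: "p \<noteq> 0"
    using p by (simp add: irreducible_def)
  show "p dvd f \<or> p dvd g"
  proof (cases "p \<in> poly_in S")
    case True
    then show ?thesis
      using old p f g dvd by blast
  next
    case pS: False
    \<comment> \<open>Such a q would differ from p by a unit, and p would then not involve the new
      variable either.\<close>
    have not_dvd: "\<not> q dvd p" if q: "irreducible q" "q \<in> poly_in S" for q
    proof
      assume "q dvd p"
      then obtain k where k: "p = q * k" by blast
      then have "k dvd 1"
        using p q(1) by (auto simp: irreducible_def)
      then obtain w where "1 = k * w" by blast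
      then have "p * w = q"
        using k by (metis mult.assoc mult_1_right)
      then show False
        using poly_in_divisor[of p w S] q pS by (auto simp: irreducible_def)
    qed
    have cancel: "c \<in> poly_in S \<Longrightarrow> h \<in> poly_in ?T \<Longrightarrow> p dvd c * h \<Longrightarrow> p dvd h" if "c \<noteq> 0" for c h
      using that
    proof (induction c arbitrary: h rule: factor_induct)
      case (unit u)
      then show ?case by (blast intro: unit_times_dvd)
    next
      case (irreducible q c)
      have qc: "q \<in> poly_in S" "c \<in> poly_in S"
        using irreducible poly_in_divisor[of q c S] poly_in_divisor'[of q c S] by (auto simp: irreducible_def)
      show ?case
      proof (cases "h = 0")
        case False
        obtain s where s: "q * c * h = p * s"
          using irreducible.prems(3) by blast
        have nz: "q * c * h \<noteq> 0"
          using False irreducible by (auto simp: irreducible_def)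
        have "q * c * h \<in> poly_in ?T"
          using irreducible.prems poly_in_mono[of _ S ?T] by (intro poly_in_mult[of _ ?T h]) auto
        then have "s \<in> poly_in ?T"
          using poly_in_divisor'[of p s ?T] s nz by simp
        moreover have "q dvd p * s"
          using s by (metis dvd_triv_left mult.assoc)
        ultimately have "q dvd s"
          using old[OF irreducible.hyps(1) qc(1) pT] not_dvd[OF irreducible.hyps(1) qc(1)] by blast
        then obtain t where "s = q * t" by blast
        then have "q * (c * h) = q * (p * t)"
          using s by (simp add: ac_simps)
        then have "c * h = p * t"
          using irreducible.hyps(1) by (auto simp: irreducible_def)
        then show ?thesis
          using irreducible.IH irreducible.prems qc(2) by simp
      qed simp
    qed
    \<comment> \<open>The prime factors of c are distributed over q and h. Those that fall on h are
      collected in d, and what is left of h divides p.\<close>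
    have strip: "c \<in> poly_in S \<Longrightarrow> q \<in> poly_in ?T \<Longrightarrow> h \<in> poly_in ?T \<Longrightarrow> c * p = q * h \<Longrightarrow>
        \<exists>d h'. d \<noteq> 0 \<and> d \<in> poly_in S \<and> h = d * h' \<and> h' dvd p" if "c \<noteq> 0" for c q h
      using that
    proof (induction c arbitrary: q h rule: factor_induct)
      case (unit u)
      then have "h dvd p"
        by (metis dvd_triv_right unit_times_dvd)
      then show ?case
        by (intro exI[of _ 1] exI[of _ h]) simp
    next
      case (irreducible r c)
      have rc: "r \<in> poly_in S" "c \<in> poly_in S"
        using irreducible poly_in_divisor[of r c S] poly_in_divisor'[of r c S] by (auto simp: irreducible_def)
      have r0: "r \<noteq> 0"
        using irreducible.hyps(1) by (auto simp: irreducible_def)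
      have nz: "q * h \<noteq> 0"
        using irreducible.prems(4) r0 irreducible.hyps(2) p0 by (metis mult_eq_0_iff)
      have "r dvd q * h"
        using irreducible.prems(4) by (metis dvd_triv_left mult.assoc)
      then consider "r dvd q" | "r dvd h"
        using old irreducible.hyps(1) rc(1) irreducible.prems by blast
      then show ?case
      proof cases
        case 1
        then obtain q1 where q1: "q = r * q1" by blast
        then have "r * (c * p) = r * (q1 * h)"
          using irreducible.prems(4) by (simp add: ac_simps)
        then have "c * p = q1 * h"
          using r0 by simp
        moreover have "q1 \<in> poly_in ?T"
          using poly_in_divisor'[of r q1 ?T] q1 irreducible.prems(2) nz by auto
        ultimately show ?thesis
          using irreducible.IH rc(2) irreducible.prems(3) by blast
      next
        case 2
        then obtain h1 where h1: "h = r * h1" by blast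
        then have "r * (c * p) = r * (q * h1)"
          using irreducible.prems(4) by (simp add: ac_simps)
        then have "c * p = q * h1"
          using r0 by simp
        moreover have "h1 \<in> poly_in ?T"
          using poly_in_divisor'[of r h1 ?T] h1 irreducible.prems(3) nz by auto
        ultimately obtain d h' where "d \<noteq> 0" "d \<in> poly_in S" "h1 = d * h'" "h' dvd p"
          using irreducible.IH rc(2) irreducible.prems(2) by blast
        then show ?thesis
          using h1 r0 rc(1) by (intro exI[of _ "r * d"] exI[of _ h']) (simp add: poly_in_mult mult.assoc)
      qed
    qed
    show ?thesis
    proof (rule ccontr)
      assume neg: "\<not> ?thesis"
      define J where "J = {h \<in> poly_in ?T. p dvd h * g}"
      define n where "n = (LEAST n. \<exists>h\<in>J. h \<noteq> 0 \<and> h \<in> low i n)"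
      have "\<exists>n. \<exists>h\<in>J. h \<noteq> 0 \<and> h \<in> low i n"
      proof -
        obtain n where "p \<in> low i n"
          using low_exists by blast
        then show ?thesis
          using p0 pT by (intro exI[of _ n] bexI[of _ p]) (auto simp: J_def)
      qed
      then have "\<exists>h\<in>J. h \<noteq> 0 \<and> h \<in> low i n"
        unfolding n_def by (rule LeastI_ex)
      then obtain h where h: "h \<in> J" "h \<noteq> 0" "h \<in> low i n"
        by blast
      then obtain d where d: "n = Suc d"
        by (cases n) auto
      have min: "r = 0" if "r \<in> J" "r \<in> low i d" for r
        using not_less_Least[of d "\<lambda>n. \<exists>h\<in>J. h \<noteq> 0 \<and> h \<in> low i n"] that d n_def by auto
      obtain h0 h1 where h': "h = X i ^ d * h0 + h1" "h0 \<in> low i 1" "h1 \<in> low i d" "h0 \<in> poly_in ?T" "h1 \<in> poly_in ?T"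
        using low_decompose[of h i d ?T] h d by (auto simp: J_def)
      have h0: "h0 \<noteq> 0"
        using min[of h] h h' by auto
      have div: "\<exists>c q. c \<noteq> 0 \<and> c \<in> poly_in S \<and> q \<in> poly_in ?T \<and> c * u = q * h" if u: "u \<in> J" for u
      proof -
        obtain k where "u \<in> low i k"
          using low_exists by blast
        then obtain c q r where *: "c \<noteq> 0" "c \<in> low i 1" "c \<in> poly_in ?T" "q \<in> poly_in ?T" "r \<in> poly_in ?T"
            "r \<in> low i d" "c * u = q * h + r"
          using pseudo_division[OF h'(1) h0 h'(2-5), of u k] u by (auto simp: J_def)
        have r: "r = c * u - q * h"
          by (simp add: *(7))
        have "r * g = c * (u * g) - q * (h * g)"
          unfolding r by (simp add: algebra_simps)
        moreover have "p dvd c * (u * g) - q * (h * g)"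
          using u h(1) by (intro dvd_diff dvd_mult[of p "u * g" c] dvd_mult[of p "h * g" q]) (auto simp: J_def)
        ultimately have "r = 0"
          using *(5,6) by (intro min) (auto simp: J_def)
        then show ?thesis
          using * poly_in_insert_low by auto
      qed
      obtain c q where "c \<noteq> 0" "c \<in> poly_in S" "q \<in> poly_in ?T" "c * p = q * h"
        using div[of p] pT by (auto simp: J_def)
      then obtain d h' where dh: "d \<noteq> 0" "d \<in> poly_in S" "h = d * h'" "h' dvd p"
        using strip[of c q h] h(1) by (auto simp: J_def)
      then obtain k where k: "p = h' * k" by blast
      \<comment> \<open>Irreducibility decides which factor is excluded: if h' is a unit, p divides
        d * g and hence g; if k is a unit, p divides h, so it divides c * f and hence f.\<close>
      have "h' dvd 1 \<or> k dvd 1"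
        using p k by (auto simp: irreducible_def)
      then show False
      proof
        assume "h' dvd 1"
        moreover have "p dvd h' * (d * g)"
          using h(1) dh(3) by (simp add: J_def ac_simps)
        ultimately have "p dvd d * g"
          by (rule unit_times_dvd)
        then show False
          using cancel dh g neg by blast
      next
        assume "k dvd 1"
        moreover have "p dvd k * h'"
          using k by (simp add: mult.commute)
        ultimately have ph: "p dvd h"
          using unit_times_dvd[of k p h'] dh(3) by simp
        obtain c q where cq: "c \<noteq> 0" "c \<in> poly_in S" "q \<in> poly_in ?T" "c * f = q * h"
          using div[of f] f dvd by (auto simp: J_def)
        then have "p dvd c * f"
          using ph by simp
        then show False
          using cancel cq f neg by blast
      qed
    qed
  qed
qed

lemma primes_in_finite: "finite S \<Longrightarrow> primes_in S"
  by (induction S rule: finite_induct) (auto intro: primes_in_empty primes_in_insert)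

theorem irreducible_dvd_mult:
  fixes p f g :: "'m \<Rightarrow>\<^sub>0 int"
  assumes "irreducible p" "p dvd f * g"
  shows "p dvd f \<or> p dvd g"
proof -
  let ?V = "\<lambda>f :: 'm \<Rightarrow>\<^sub>0 int. \<Union>m\<in>keys f. {i. e m i \<noteq> 0}"
  have in_V: "h \<in> poly_in S" if "?V h \<subseteq> S" for h S
    using that by (auto simp: poly_in_def supported_def)
  have "primes_in (?V p \<union> ?V f \<union> ?V g)"
    by (intro primes_in_finite finite_UnI finite_UN_I finite_keys e_finite)
  then show ?thesis
    using assms in_V unfolding primes_in_def by (meson Un_upper1 Un_upper2 order_trans)
qed

lemma unit_cases: "u dvd 1 \<Longrightarrow> u = 1 \<or> u = - 1"
  for u :: "'m \<Rightarrow>\<^sub>0 int"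
proof -
  assume "u dvd 1"
  then obtain w where w: "1 = u * w" by blast
  then have "u \<in> poly_in {}" "w \<in> poly_in {}"
    using poly_in_divisor[of u w "{}"] poly_in_divisor'[of u w "{}"] by (metis poly_in_one zero_neq_one)+
  then obtain a b where ab: "u = of_int a" "w = of_int b"
    unfolding poly_in_empty_iff by blast
  then have "(of_int 1 :: 'm \<Rightarrow>\<^sub>0 int) = of_int (a * b)"
    using w by simp
  then have "a * b = 1"
    unfolding of_int_eq_iff by simp
  then show ?thesis
    using ab zmult_eq_1_iff by auto
qed

section \<open>Fractions in lowest terms\<close>

definition coprime_pair :: "('m \<Rightarrow>\<^sub>0 int) \<Rightarrow> ('m \<Rightarrow>\<^sub>0 int) \<Rightarrow> bool" where
  "coprime_pair a b \<longleftrightarrow> (\<forall>d. d dvd a \<longrightarrow> d dvd b \<longrightarrow> d dvd 1)"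

text \<open>The irreducible factors of b are removed one by one: each is prime and divides a * c,
  but it cannot divide a because it would be a common non-unit divisor.\<close>

lemma coprime_pair_dvd:
  assumes "b \<noteq> 0" "coprime_pair a b" "b dvd a * c"
  shows "b dvd c"
  using assms
proof (induction b arbitrary: c rule: factor_induct)
  case (unit u)
  then show ?case using dvd_trans[of u 1 c] by simp
next
  case (irreducible p b)
  have "p dvd a * c"
    using irreducible.prems(2) dvd_mult_left by blast
  moreover have "\<not> p dvd a"
    using irreducible.prems(1) irreducible.hyps(1) by (auto simp: coprime_pair_def irreducible_def)
  ultimately obtain c1 where c1: "c = p * c1"
    using irreducible_dvd_mult[OF irreducible.hyps(1)] by blast
  have "p * b dvd p * (a * c1)"
    using irreducible.prems(2) c1 by (simp add: ac_simps)
  then have "b dvd a * c1"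
    using irreducible.hyps(1) by (auto simp: irreducible_def)
  moreover have "coprime_pair a b"
    using irreducible.prems(1) unfolding coprime_pair_def by (metis dvd_mult)
  ultimately have "b dvd c1"
    using irreducible.IH by blast
  then show ?case
    unfolding c1 by (rule mult_dvd_mono[OF dvd_refl])
qed

text \<open>Coprimality makes each denominator divide the other, so they differ by a unit, and
  cancelling shows that the numerators differ by the same one.\<close>

lemma coprime_pair_unique:
  assumes "coprime_pair a b" "coprime_pair a' b'" "b \<noteq> 0" "b' \<noteq> 0" "a * b' = a' * b"
  shows "\<exists>u. u dvd 1 \<and> a' = u * a \<and> b' = u * b"
proof -
  have "b dvd b'"
    using coprime_pair_dvd[OF assms(3,1), of b'] assms(5) by simp
  moreover have "b' dvd b"
    using coprime_pair_dvd[OF assms(4,2), of b] assms(5) by (metis dvd_triv_right)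
  ultimately obtain u w where u: "b' = b * u" "b = b' * w"
    by (metis dvdE)
  then have "b * 1 = b * (u * w)"
    by (metis mult.assoc mult_1_right)
  then have "1 = u * w"
    using assms(3) by simp
  then have "u dvd 1"
    by (rule dvdI)
  moreover have "b * (u * a) = b * a'"
    using assms(5) u(1) by (simp add: ac_simps)
  then have "a' = u * a"
    using assms(3) by simp
  ultimately show ?thesis
    using u(1) by (auto simp: mult.commute)
qed

text \<open>Common non-unit divisors are cancelled as long as there are any. The size of the
  denominator alone controls termination, so x may be 0.\<close>

lemma coprime_pair_exists:
  "y \<noteq> 0 \<Longrightarrow> \<exists>a b d. x = d * a \<and> y = d * b \<and> coprime_pair a b"
proof (induction y arbitrary: x rule: measure_induct_rule[of msize])
  case (less y)
  show ?case
  proof (cases "coprime_pair x y")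
    case True
    then show ?thesis by (metis mult_1)
  next
    case False
    then obtain d x' y' where d: "\<not> d dvd 1" "x = d * x'" "y = d * y'"
      unfolding coprime_pair_def by blast
    then have "msize y' < msize y"
      using msize_less[of y' d] less.prems by (auto simp: mult.commute)
    then obtain a b c where "x' = c * a" "y' = c * b" "coprime_pair a b"
      using less.IH[of y' x'] less.prems d by auto
    then show ?thesis
      using d by (metis mult.assoc)
  qed
qed

end

section \<open>The ordered monoid of ordinals under natural addition\<close>

text \<open>The universe also contains sets that are not ordinals; a type of ordinals alone can
  serve as exponent monoid of a monoid ring.\<close>

typedef (overloaded) 'v ordinal = "{x :: 'v::set_universe. Ord x}" morphisms rep_ordinal abs_ordinal
  using Ord_zero by blast

lemma Ord_rep [simp]: "Ord (rep_ordinal a)"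
  using rep_ordinal by blast

lemma rep_abs [simp]: "Ord x \<Longrightarrow> rep_ordinal (abs_ordinal x) = x"
  by (simp add: abs_ordinal_inverse)

lemmas abs_rep [simp] = rep_ordinal_inverse

lemma rep_eq_iff [simp]: "rep_ordinal a = rep_ordinal b \<longleftrightarrow> a = b"
  by (rule rep_ordinal_inject)

instantiation ordinal :: (set_universe) linorder
begin

definition less_ordinal :: "'a ordinal \<Rightarrow> 'a ordinal \<Rightarrow> bool" where
  "a < b \<longleftrightarrow> oless (rep_ordinal a) (rep_ordinal b)"

definition less_eq_ordinal :: "'a ordinal \<Rightarrow> 'a ordinal \<Rightarrow> bool" where
  "a \<le> b \<longleftrightarrow> ole (rep_ordinal a) (rep_ordinal b)"

instance
proof
  fix x y z :: "'a ordinal"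
  show "x < y \<longleftrightarrow> x \<le> y \<and> \<not> y \<le> x"
    using elem_asym[of "rep_ordinal x" "rep_ordinal y"] elem_irrefl[of "rep_ordinal x"]
    by (auto simp: less_ordinal_def less_eq_ordinal_def ole_def oless_def)
  show "x \<le> x"
    by (simp add: less_eq_ordinal_def ole_def)
  show "x \<le> y \<Longrightarrow> y \<le> z \<Longrightarrow> x \<le> z"
    by (auto simp: less_eq_ordinal_def ole_iff_subset)
  show "x \<le> y \<Longrightarrow> y \<le> x \<Longrightarrow> x = y"
    using elem_asym[of "rep_ordinal x" "rep_ordinal y"]
    by (auto simp: less_eq_ordinal_def ole_def oless_def)
  show "x \<le> y \<or> y \<le> x"
    using Ord_linear[of "rep_ordinal x" "rep_ordinal y"]
    by (auto simp: less_eq_ordinal_def ole_def oless_def)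
qed

end

definition ocoeff :: "'v::set_universe ordinal \<Rightarrow> 'v ordinal \<Rightarrow> nat" where
  "ocoeff a i = cnf_coeff (rep_ordinal a) (rep_ordinal i)"

lemma cnf_coeff_rep: "cnf_coeff (rep_ordinal a) z = (if Ord z then ocoeff a (abs_ordinal z) else 0)"
  using cnf_coeff_support[of "rep_ordinal a" z] by (auto simp: ocoeff_def)

lemma ocoeff_inj: "(\<And>i. ocoeff a i = ocoeff b i) \<Longrightarrow> a = b"
  using cnf_coeff_inj[of "rep_ordinal a" "rep_ordinal b"] by (simp add: fun_eq_iff cnf_coeff_rep)

lemma finite_ocoeff: "finite {i. ocoeff a i \<noteq> 0}"
proof (rule finite_imageD)
  show "finite (rep_ordinal ` {i. ocoeff a i \<noteq> 0})"
    by (rule finite_subset[OF _ finite_cnf_coeff[of "rep_ordinal a"]]) (auto simp: ocoeff_def)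
qed (simp add: inj_on_def)

lemma less_iff_ocoeff: "a < b \<longleftrightarrow> (\<exists>i. ocoeff a i < ocoeff b i \<and> (\<forall>j>i. ocoeff a j = ocoeff b j))"
proof -
  have "a < b \<longleftrightarrow> lex_less (cnf_coeff (rep_ordinal a)) (cnf_coeff (rep_ordinal b))"
    by (simp add: less_ordinal_def oless_iff_lex_less)
  also have "\<dots> \<longleftrightarrow> (\<exists>i. ocoeff a i < ocoeff b i \<and> (\<forall>j>i. ocoeff a j = ocoeff b j))"
  proof
    assume "lex_less (cnf_coeff (rep_ordinal a)) (cnf_coeff (rep_ordinal b))"
    then obtain z where z: "Ord z" "cnf_coeff (rep_ordinal a) z < cnf_coeff (rep_ordinal b) z"
      "\<forall>y. z \<in> elts y \<longrightarrow> cnf_coeff (rep_ordinal a) y = cnf_coeff (rep_ordinal b) y"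
      unfolding lex_less_def by blast
    then show "\<exists>i. ocoeff a i < ocoeff b i \<and> (\<forall>j>i. ocoeff a j = ocoeff b j)"
      by (intro exI[of _ "abs_ordinal z"]) (auto simp: ocoeff_def less_ordinal_def oless_def)
  next
    assume "\<exists>i. ocoeff a i < ocoeff b i \<and> (\<forall>j>i. ocoeff a j = ocoeff b j)"
    then obtain i where i: "ocoeff a i < ocoeff b i" "\<forall>j>i. ocoeff a j = ocoeff b j"
      by blast
    show "lex_less (cnf_coeff (rep_ordinal a)) (cnf_coeff (rep_ordinal b))"
      unfolding lex_less_def
      by (rule exI[of _ "rep_ordinal i"]) (use i in \<open>auto simp: cnf_coeff_rep less_ordinal_def oless_def\<close>)
  qed
  finally show ?thesis .
qed

lemma ocoeff_surj:
  assumes "finite {i. c i \<noteq> 0}"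
  shows "\<exists>a. \<forall>i. ocoeff a i = c i"
proof -
  have "\<exists>xs. is_cnf xs \<and> fst ` set xs \<subseteq> rep_ordinal ` S \<and>
      (\<forall>i. coeff_of xs (rep_ordinal i) = (if i \<in> S then c i else 0))"
    if "finite S" "S \<subseteq> {i. c i \<noteq> 0}" for S
    using that
  \<comment> \<open>Exponents are added in increasing order, so each new one becomes the head of the
    list.\<close>
  proof (induction S rule: finite_linorder_max_induct)
    case empty
    then show ?case by (intro exI[of _ "[]"]) simp
  next
    case (insert b S)
    then obtain xs where xs: "is_cnf xs" "fst ` set xs \<subseteq> rep_ordinal ` S"
        "\<forall>i. coeff_of xs (rep_ordinal i) = (if i \<in> S then c i else 0)"
      by auto
    have "\<forall>p\<in>set xs. fst p \<in> elts (rep_ordinal b)"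
      using xs(2) insert.hyps(2) by (force simp: less_ordinal_def oless_def)
    then show ?case
      using xs insert.prems by (intro exI[of _ "(rep_ordinal b, c b) # xs"]) auto
  qed
  from this[OF assms] obtain xs where xs: "is_cnf xs"
      "\<forall>i. coeff_of xs (rep_ordinal i) = (if i \<in> {i. c i \<noteq> 0} then c i else 0)"
    by blast
  then show ?thesis
    by (intro exI[of _ "abs_ordinal (cnf_value xs)"]) (simp add: ocoeff_def cnf_coeff_eq cnf_cnf_value)
qed

section \<open>Ordinals as finitely supported functions\<close>

definition opoly :: "'v::set_universe ordinal \<Rightarrow> 'v ordinal \<Rightarrow>\<^sub>0 nat" where
  "opoly a = Abs_poly_mapping (ocoeff a)"

text \<open>A genuine inverse: by \<open>ocoeff_surj\<close> every finitely supported function is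
  the coefficient function of an ordinal.\<close>

definition ordp :: "('v::set_universe ordinal \<Rightarrow>\<^sub>0 nat) \<Rightarrow> 'v ordinal" where
  "ordp f = inv opoly f"

lemma lookup_opoly [simp]: "lookup (opoly a) = ocoeff a"
  unfolding opoly_def by (rule lookup_Abs_poly_mapping[OF finite_ocoeff])

lemma opoly_inj: "opoly a = opoly b \<longleftrightarrow> a = b"
  by (metis lookup_opoly ocoeff_inj)

lemma opoly_ordp [simp]: "opoly (ordp f) = f"
proof -
  obtain a where "\<forall>i. ocoeff a i = lookup f i"
    using ocoeff_surj[of "lookup f"] finite_lookup by blast
  then have "opoly a = f"
    by (intro poly_mapping_eqI) simp
  then show ?thesis
    unfolding ordp_def by (intro f_inv_into_f) blast
qed

lemma ocoeff_ordp [simp]: "ocoeff (ordp f) i = lookup f i"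
  by (metis lookup_opoly opoly_ordp)

text \<open>
  Subtraction is truncated coefficientwise; it is present because the class of cancellative monoids
  demands it.
\<close>

instantiation ordinal :: (set_universe) "{zero, plus, minus}"
begin

definition zero_ordinal :: "'a ordinal" where "0 = ordp 0"
definition plus_ordinal :: "'a ordinal \<Rightarrow> 'a ordinal \<Rightarrow> 'a ordinal" where "a + b = ordp (opoly a + opoly b)"
definition minus_ordinal :: "'a ordinal \<Rightarrow> 'a ordinal \<Rightarrow> 'a ordinal" where "a - b = ordp (opoly a - opoly b)"

instance ..

end

lemma ocoeff_zero [simp]: "ocoeff 0 i = 0"
  by (simp add: zero_ordinal_def)

lemma ocoeff_add [simp]: "ocoeff (a + b) i = ocoeff a i + ocoeff b i"
  by (simp add: plus_ordinal_def lookup_add)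

lemma ocoeff_diff [simp]: "ocoeff (a - b) i = ocoeff a i - ocoeff b i"
  by (simp add: minus_ordinal_def lookup_minus)

text \<open>Adding c changes both coefficient functions by the same amount, so the highest place of
  difference and its direction are preserved.\<close>

instance ordinal :: (set_universe) ordered_cancel_comm_monoid_add
proof
  fix a b c :: "'a ordinal"
  show "a + b + c = a + (b + c)" "a + b = b + a" "0 + a = a" "a + b - a = b" "a - b - c = a - (b + c)"
    by (rule ocoeff_inj; simp)+
  assume "a \<le> b"
  then show "c + a \<le> c + b"
    unfolding order_le_less less_iff_ocoeff[of a b] less_iff_ocoeff[of "c + a" "c + b"] by auto
qed

definition omega_power :: "'v::set_universe ordinal \<Rightarrow> 'v ordinal" where
  "omega_power i = ordp (single i 1)"

lemma ocoeff_omega_power [simp]: "ocoeff (omega_power i) j = (if i = j then 1 else 0)"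
  by (simp add: omega_power_def lookup_single when_def)

text \<open>Exponents are ordinals themselves, so the normal form is used a second time: the
  variable \<open>X i\<close> stands for omega to the power omega^i, and its multiplicity in the
  exponent m is the coefficient of omega^i in m.\<close>

interpretation ord: free_exponents ocoeff omega_power
proof
  fix m n :: "'v::set_universe ordinal" and i j
  show "ocoeff 0 i = 0" "ocoeff (m + n) i = ocoeff m i + ocoeff n i"
    "ocoeff (omega_power i) j = (if i = j then 1 else 0)" "finite {i. ocoeff m i \<noteq> 0}"
    by (simp_all add: finite_ocoeff[simplified])
  show "(\<And>i. ocoeff m i = ocoeff n i) \<Longrightarrow> m = n"
    by (rule ocoeff_inj)
  show "\<exists>n. m = omega_power i + n" if "0 < ocoeff m i"
    by (intro exI[of _ "m - omega_power i"] ocoeff_inj) (use that in auto)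
  show "0 \<le> m"
    unfolding not_less[symmetric] less_iff_ocoeff[of m 0] by simp
qed

text \<open>The coefficient functions of the definitions live on the whole universe; extension by 0
  matches the value of \<open>cnf_coeff\<close> outside the ordinals.\<close>

definition ext :: "('v::set_universe ordinal \<Rightarrow>\<^sub>0 'r::zero) \<Rightarrow> 'v \<Rightarrow> 'r" where
  "ext f z = (if Ord z then lookup f (abs_ordinal z) else 0)"

lemma ext_rep [simp]: "ext f (rep_ordinal i) = lookup f i"
  by (simp add: ext_def)

lemma cnf_coeff_rep_eq_ext: "cnf_coeff (rep_ordinal a) = ext (opoly a)"
  by (simp add: fun_eq_iff ext_def cnf_coeff_rep)

lemma ext_nonzero: "ext f z \<noteq> 0 \<longleftrightarrow> (\<exists>i\<in>keys f. z = rep_ordinal i)"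
proof (cases "Ord z")
  case True
  then obtain i where "z = rep_ordinal i"
    by (metis rep_abs)
  then show ?thesis
    by (simp add: in_keys_iff)
next
  case False
  then have "z \<noteq> rep_ordinal i" for i
    by auto
  then show ?thesis
    using False by (simp add: ext_def)
qed

lemma ord_of_coeffs_ext [simp]: "ord_of_coeffs (ext f) = rep_ordinal (ordp f)"
  unfolding ord_of_coeffs_def
proof (rule the_equality)
  show *: "Ord (rep_ordinal (ordp f)) \<and> cnf_coeff (rep_ordinal (ordp f)) = ext f"
    by (simp add: cnf_coeff_rep_eq_ext)
  show "Ord x \<and> cnf_coeff x = ext f \<Longrightarrow> x = rep_ordinal (ordp f)" for x
    using * by (intro cnf_coeff_inj) auto
qed

lemma nat_sum_rep: "rep_ordinal a \<oplus> rep_ordinal b = rep_ordinal (a + b)"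
proof -
  have "(\<lambda>z. cnf_coeff (rep_ordinal a) z + cnf_coeff (rep_ordinal b) z) = ext (opoly a + opoly b)"
    by (simp add: fun_eq_iff cnf_coeff_rep_eq_ext) (simp add: ext_def lookup_add)
  then show ?thesis
    by (simp add: nat_sum_def plus_ordinal_def)
qed

lemma conv_ext: "conv (ext f) (ext g) = ext (f * g)"
proof
  fix t
  let ?A = "{(a, b). a \<in> keys f \<and> b \<in> keys g \<and> rep_ordinal (a + b) = t}"
  let ?r = "\<lambda>(a, b). (rep_ordinal a, rep_ordinal b)"
  have "{(z, y). ext f z \<noteq> 0 \<and> ext g y \<noteq> 0 \<and> z \<oplus> y = t} = ?r ` ?A" (is "?B = _")
  proof (intro equalityI subsetI)
    fix p assume "p \<in> ?B"
    then obtain z y where p: "p = (z, y)" "ext f z \<noteq> 0" "ext g y \<noteq> 0" "z \<oplus> y = t"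
      by blast
    then obtain a b where "a \<in> keys f" "b \<in> keys g" "z = rep_ordinal a" "y = rep_ordinal b"
      unfolding ext_nonzero by blast
    with p show "p \<in> ?r ` ?A"
      by (intro image_eqI[of _ _ "(a, b)"]) (simp_all add: nat_sum_rep)
  next
    fix p assume "p \<in> ?r ` ?A"
    then show "p \<in> ?B"
      by (auto simp: nat_sum_rep in_keys_iff)
  qed
  moreover have "inj_on ?r ?A"
    by (auto simp: inj_on_def)
  ultimately have "conv (ext f) (ext g) t = (\<Sum>(a, b)\<in>?A. lookup f a * lookup g b)"
    by (simp add: conv_def sum.reindex case_prod_unfold)
  also have "\<dots> = ext (f * g) t"
  proof (cases "Ord t")
    case True
    then have "rep_ordinal a = t \<longleftrightarrow> a = abs_ordinal t" for a
      by (metis abs_rep rep_abs)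
    then show ?thesis
      using True by (simp add: ext_def lookup_times)
  next
    case False
    then have "rep_ordinal a \<noteq> t" for a
      by auto
    then show ?thesis
      using False by (simp add: ext_def)
  qed
  finally show "conv (ext f) (ext g) t = ext (f * g) t" .
qed

lemma nat_prod_rep: "rep_ordinal a \<otimes> rep_ordinal b = rep_ordinal (ordp (opoly a * opoly b))"
  by (simp add: nat_prod_def cnf_coeff_rep_eq_ext conv_ext)

section \<open>Multiplicatively closed ordinals\<close>

lemma rep_zero: "rep_ordinal 0 = (vset {} :: 'v::set_universe)"
proof -
  have "cnf (vset {} :: 'v) = []"
    using cnf_cnf_value[of "[]"] by simp
  then have "ocoeff (abs_ordinal (vset {} :: 'v)) i = 0" for i
    by (simp add: ocoeff_def cnf_coeff_def)
  then have "abs_ordinal (vset {} :: 'v) = 0"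
    by (intro ocoeff_inj) simp
  then show ?thesis
    by (metis Ord_zero rep_abs)
qed

lemma omega_pow_zero_omul: "omul (omega_pow (vset {})) (ord_of_nat n) = (ord_of_nat n :: 'v::set_universe)"
proof (induction n rule: less_induct)
  case (less n)
  have "elts (omega_pow (vset {} :: 'v)) = {vset {}}"
    by (simp add: elts_omega_pow)
  then show ?case
    using less by (intro extensionality) (auto simp: elts_omul elts_ord_of_nat)
qed

text \<open>The normal form is omega^0 * n, except that 0 has the empty one.\<close>

lemma ocoeff_ord_of_nat:
  fixes i :: "'v::set_universe ordinal"
  shows "ocoeff (abs_ordinal (ord_of_nat n)) i = (if i = 0 then n else 0)"
proof (cases "n = 0")
  case True
  then show ?thesis
    using rep_zero by (metis abs_rep ocoeff_zero ord_of_nat.simps(1))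
next
  case False
  have "cnf_value [(rep_ordinal 0, n)] = (ord_of_nat n :: 'v)"
    by (simp add: rep_zero omega_pow_zero_omul)
  moreover have "is_cnf [(rep_ordinal (0 :: 'v ordinal), n)]"
    using False by simp
  ultimately have "cnf (ord_of_nat n :: 'v) = [(rep_ordinal 0, n)]"
    using cnf_cnf_value by metis
  then show ?thesis
    by (simp add: ocoeff_def cnf_coeff_def)
qed

lemma opoly_ord_of_nat: "opoly (abs_ordinal (ord_of_nat n)) = single 0 n"
  by (rule poly_mapping_eqI) (simp add: ocoeff_ord_of_nat lookup_single when_def)

lemma opoly_omega_power: "opoly (omega_power i) = single i 1"
  by (simp add: omega_power_def)

lemma omega_power_mono: "i \<le> j \<Longrightarrow> omega_power i \<le> omega_power j"
proof -
  assume "i \<le> j"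
  then have "\<not> omega_power j < omega_power i"
    unfolding less_iff_ocoeff[of "omega_power j"] by (auto split: if_splits)
  then show ?thesis by simp
qed

lemma omega_power_le: "ocoeff a i \<noteq> 0 \<Longrightarrow> omega_power i \<le> a"
proof -
  assume "ocoeff a i \<noteq> 0"
  then have "\<not> a < omega_power i"
    unfolding less_iff_ocoeff[of a] by (auto split: if_splits)
  then show ?thesis by simp
qed

definition exponents_below :: "'v::set_universe ordinal \<Rightarrow> 'v ordinal set" where
  "exponents_below L = {i. omega_power i < L}"

lemma exponents_below_down: "j \<in> exponents_below L \<Longrightarrow> i \<le> j \<Longrightarrow> i \<in> exponents_below L"
  using omega_power_mono[of i j] by (auto simp: exponents_below_def)

context
  fixes L :: "'v::set_universe ordinal"
  assumes L: "times_number (rep_ordinal L)"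
begin

lemma times_number_mult: "a < L \<Longrightarrow> b < L \<Longrightarrow> ordp (opoly a * opoly b) < L"
proof -
  assume "a < L" "b < L"
  then have "oless (rep_ordinal a \<otimes> rep_ordinal b) (rep_ordinal L)"
    using L unfolding times_number_def less_ordinal_def by blast
  then show ?thesis
    by (simp add: nat_prod_rep less_ordinal_def)
qed

lemma ord_of_nat_less_times_number: "abs_ordinal (ord_of_nat n) < L"
proof -
  have "elts omega \<subseteq> elts (rep_ordinal L)"
    using L unfolding times_number_def by (simp add: ole_iff_subset)
  then show ?thesis
    by (auto simp: less_ordinal_def oless_def elts_omega)
qed

lemma zero_exponents_below: "0 \<in> exponents_below L"
proof -
  have "omega_power 0 = (abs_ordinal (ord_of_nat 1) :: 'v ordinal)"
    by (rule ocoeff_inj) (simp add: ocoeff_ord_of_nat)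
  then show ?thesis
    using ord_of_nat_less_times_number[of 1] by (simp add: exponents_below_def)
qed

text \<open>The natural product of omega^i and omega^j is omega to the power i + j, so closure of L
  under products becomes closure of its exponents under sums.\<close>

lemma add_exponents_below:
  "i \<in> exponents_below L \<Longrightarrow> j \<in> exponents_below L \<Longrightarrow> i + j \<in> exponents_below L"
  using times_number_mult[of "omega_power i" "omega_power j"]
  by (simp add: exponents_below_def opoly_omega_power mult_single omega_power_def)

lemma less_times_number_iff: "a < L \<longleftrightarrow> keys (opoly a) \<subseteq> exponents_below L"
proof
  assume "a < L"
  then have "omega_power i < L" if "ocoeff a i \<noteq> 0" for i
    using omega_power_le[OF that] by simp
  then show "keys (opoly a) \<subseteq> exponents_below L"
    by (auto simp: exponents_below_def in_keys_iff)
next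
  assume keys: "keys (opoly a) \<subseteq> exponents_below L"
  show "a < L"
  proof (cases "opoly a = 0")
    case True
    then have "a = abs_ordinal (ord_of_nat 0)"
      by (intro ocoeff_inj) (metis lookup_opoly lookup_zero ocoeff_ord_of_nat)
    then show ?thesis
      using ord_of_nat_less_times_number[of 0] by metis
  next
    case False
    define m where "m = lead (opoly a)"
    have m: "m \<in> keys (opoly a)"
      unfolding m_def using False by (rule lead_in_keys)
    \<comment> \<open>With m the leading exponent of a and c its coefficient, a lies below omega^m *
      (c + 1). This bound is the natural product of omega^m and a natural number, both below
      L.\<close>
    let ?b = "ordp (single m (Suc (ocoeff a m)))"
    have "a < ?b"
      unfolding less_iff_ocoeff[of a ?b]
    proof (intro exI[of _ m] conjI allI impI)
      show "ocoeff a m < ocoeff ?b m"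
        by simp
      fix j assume "m < j"
      then have "j \<notin> keys (opoly a)"
        using lead_ge[of j "opoly a"] by (auto simp: m_def)
      then show "ocoeff a j = ocoeff ?b j"
        using \<open>m < j\<close> by (simp add: in_keys_iff lookup_single when_def)
    qed
    also have "?b = ordp (opoly (omega_power m) * opoly (abs_ordinal (ord_of_nat (Suc (ocoeff a m)))))"
      by (simp only: opoly_omega_power opoly_ord_of_nat mult_single) simp
    also have "\<dots> < L"
      using keys m by (intro times_number_mult ord_of_nat_less_times_number) (auto simp: exponents_below_def)
    finally show ?thesis .
  qed
qed

end

lemma elem_omega_pow_rep: "rep_ordinal a \<in> elts (omega_pow (rep_ordinal b)) \<longleftrightarrow> (\<forall>i\<in>keys (opoly a). i < b)"
proof -
  have "rep_ordinal a \<in> elts (omega_pow (rep_ordinal b)) \<longleftrightarrow>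
      (\<forall>z. ext (opoly a) z \<noteq> 0 \<longrightarrow> z \<in> elts (rep_ordinal b))"
    by (simp add: elem_omega_pow_iff_cnf cnf_coeff_rep_eq_ext)
  then show ?thesis
    unfolding ext_nonzero less_ordinal_def oless_def by blast
qed

text \<open>The ordinals below omega^g are those with exponents below g, so they are closed under
  natural sums. Exponents of a natural product are sums of exponents of its factors, so one power
  higher there is closure under products.\<close>

lemma times_number_omega_pow:
  assumes "Ord g"
  shows "times_number (omega_pow (omega_pow g))"
  unfolding times_number_def
proof (intro conjI allI impI)
  let ?k = "omega_pow (omega_pow g)"
  define h where "h = abs_ordinal (omega_pow g)"
  have h: "omega_pow g = rep_ordinal h"
    using assms by (simp add: h_def)
  have h_closed: "0 < h" "i < h \<Longrightarrow> j < h \<Longrightarrow> i + j < h" for i j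
  proof -
    have "g = rep_ordinal (abs_ordinal g)"
      using assms by simp
    then have *: "i < h \<longleftrightarrow> (\<forall>k\<in>keys (opoly i). k < abs_ordinal g)" for i
      using elem_omega_pow_rep[of i "abs_ordinal g"] unfolding less_ordinal_def oless_def h[symmetric] by metis
    have "opoly (0 :: 'a ordinal) = 0"
      by (simp add: zero_ordinal_def)
    then show "0 < h"
      unfolding * by simp
    show "i + j < h" if "i < h" "j < h"
      using that unfolding * by (auto simp: in_keys_iff)
  qed
  show "Ord ?k"
    using assms by simp
  have "elts omega \<subseteq> elts ?k"
  proof
    fix x assume "x \<in> elts (omega :: 'a)"
    then obtain n where "x = ord_of_nat n"
      by (auto simp: elts_omega)
    then have "x = rep_ordinal (abs_ordinal (ord_of_nat n))"
      by simp
    then show "x \<in> elts ?k"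
      unfolding h using elem_omega_pow_rep[of "abs_ordinal (ord_of_nat n)" h] h_closed(1)
      by (auto simp: opoly_ord_of_nat)
  qed
  then show "ole omega ?k"
    using assms by (simp add: ole_iff_subset)
  fix x y assume xy: "oless x ?k \<and> oless y ?k"
  define a b where "a = abs_ordinal x" and "b = abs_ordinal y"
  have "Ord x" "Ord y"
    using xy Ord_elem[of ?k] assms by (auto simp: oless_def)
  then have x: "x = rep_ordinal a" and y: "y = rep_ordinal b"
    by (simp_all add: a_def b_def)
  have "\<forall>i\<in>keys (opoly a). i < h" "\<forall>i\<in>keys (opoly b). i < h"
    using xy unfolding oless_def x y h elem_omega_pow_rep by auto
  then have "\<forall>i\<in>keys (opoly a * opoly b). i < h"
    using keys_mult[of "opoly a" "opoly b"] h_closed(2) by blast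
  then show "oless (x \<otimes> y) ?k"
    unfolding oless_def x y nat_prod_rep h elem_omega_pow_rep by simp
qed

lemma times_number_unbounded:
  assumes "Ord a"
  shows "\<exists>k. times_number k \<and> oless a k"
proof (intro exI conjI)
  let ?k = "omega_pow (omega_pow (osucc a))"
  show "times_number ?k"
    using assms by (intro times_number_omega_pow) simp
  have "elts (osucc a) \<subseteq> elts ?k"
    using omega_pow_ge[of "osucc a"] omega_pow_ge[of "omega_pow (osucc a)"] assms
    by (meson Ord_omega_pow Ord_osucc order_trans)
  then show "oless a ?k"
    by (simp add: oless_def)
qed

section \<open>Surintegers as a monoid ring\<close>

type_synonym 'v zpoly = "'v ordinal \<Rightarrow>\<^sub>0 int"

text \<open>Since \<open>nat\<close> sends negative integers to 0, the two maps give the negative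
  and the positive part, in the order in which a surinteger stores them.\<close>

definition polyz :: "'v::set_universe zpoly \<Rightarrow> 'v" where
  "polyz f = vpair (rep_ordinal (ordp (Poly_Mapping.map nat (- f)))) (rep_ordinal (ordp (Poly_Mapping.map nat f)))"

lemma lookup_map_nat [simp]: "lookup (Poly_Mapping.map nat f) i = nat (lookup f i)"
  by (simp add: Poly_Mapping.map.rep_eq when_def)

lemma z_of_coeffs_ext: "z_of_coeffs (ext f) = polyz f"
proof -
  have "(\<lambda>z. nat (ext g z)) = ext (Poly_Mapping.map nat g)" for g :: "'a zpoly"
    by (simp add: fun_eq_iff ext_def)
  moreover have "(\<lambda>z. - ext f z) = ext (- f)"
    by (simp add: fun_eq_iff ext_def)
  then have "(\<lambda>z. nat (- ext f z)) = (\<lambda>z. nat (ext (- f) z))"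
    by metis
  ultimately show ?thesis
    by (simp add: z_of_coeffs_def polyz_def)
qed

lemma z_coeff_polyz [simp]: "z_coeff (polyz f) = ext f"
  by (auto simp: fun_eq_iff z_coeff_def polyz_def cnf_coeff_rep_eq_ext ext_def)

lemma polyz_eq_iff [simp]: "polyz f = polyz g \<longleftrightarrow> f = g"
proof
  assume "polyz f = polyz g"
  then have "ext f = ext g"
    by (metis z_coeff_polyz)
  then show "f = g"
    by (intro poly_mapping_eqI) (metis ext_rep)
qed simp

lemma Z_inf_eq: "Z_inf = range polyz"
proof (intro equalityI subsetI)
  fix x :: 'a assume "x \<in> range polyz"
  then show "x \<in> Z_inf"
    by (auto simp: Z_inf_def polyz_def cnf_coeff_rep_eq_ext ext_def)
next
  fix x :: 'a assume "x \<in> Z_inf"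
  then obtain y z where yz: "x = vpair y z" "Ord y" "Ord z" "\<forall>t. cnf_coeff y t = 0 \<or> cnf_coeff z t = 0"
    by (auto simp: Z_inf_def)
  define a b where "a = abs_ordinal y" and "b = abs_ordinal z"
  have ab: "y = rep_ordinal a" "z = rep_ordinal b"
    using yz by (simp_all add: a_def b_def)
  have dis: "ocoeff a i = 0 \<or> ocoeff b i = 0" for i
    using yz(4) by (simp add: ocoeff_def ab)
  \<comment> \<open>As no exponent occurs in both a and b, the subtraction never mixes coefficients,
    and the two parts of f return a and b.\<close>
  define f :: "'a zpoly" where "f = Poly_Mapping.map int (opoly b) - Poly_Mapping.map int (opoly a)"
  have f: "lookup f i = int (ocoeff b i) - int (ocoeff a i)" for i
    by (simp add: f_def lookup_minus Poly_Mapping.map.rep_eq when_def)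
  have "ordp (Poly_Mapping.map nat (- f)) = a"
  proof (rule ocoeff_inj)
    show "ocoeff (ordp (Poly_Mapping.map nat (- f))) i = ocoeff a i" for i
      using dis[of i] by (auto simp: f)
  qed
  moreover have "ordp (Poly_Mapping.map nat f) = b"
  proof (rule ocoeff_inj)
    show "ocoeff (ordp (Poly_Mapping.map nat f)) i = ocoeff b i" for i
      using dis[of i] by (auto simp: f)
  qed
  ultimately have "x = polyz f"
    by (simp add: polyz_def yz(1) ab)
  then show "x \<in> range polyz" by blast
qed

lemma polyz_in_Z_inf [simp]: "polyz f \<in> Z_inf"
  by (simp add: Z_inf_eq)

lemma Bex_Z_inf: "(\<exists>x\<in>Z_inf. P x) \<longleftrightarrow> (\<exists>f. P (polyz f))"
  and Ball_Z_inf: "(\<forall>x\<in>Z_inf. P x) \<longleftrightarrow> (\<forall>f. P (polyz f))"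
  by (simp_all add: Z_inf_eq)

lemma z_add_polyz [simp]: "z_add (polyz f) (polyz g) = polyz (f + g)"
proof -
  have "(\<lambda>z. ext f z + ext g z) = ext (f + g)"
    by (simp add: fun_eq_iff ext_def lookup_add)
  then show ?thesis
    by (simp add: z_add_def z_of_coeffs_ext)
qed

lemma z_mul_polyz [simp]: "z_mul (polyz f) (polyz g) = polyz (f * g)"
  by (simp add: z_mul_def conv_ext z_of_coeffs_ext)

lemma z_neg_polyz [simp]: "z_neg (polyz f) = polyz (- f)"
  by (simp add: z_neg_def polyz_def)

lemma z_zero_eq: "z_zero = polyz 0"
proof -
  have "ordp (Poly_Mapping.map nat (0 :: 'a zpoly)) = 0"
    by (rule ocoeff_inj) simp
  then show ?thesis
    by (simp add: z_zero_def polyz_def rep_zero)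
qed

lemma z_one_eq: "z_one = polyz 1"
proof -
  have "ordp (Poly_Mapping.map nat (- 1 :: 'a zpoly)) = 0"
    by (rule ocoeff_inj) (simp add: lookup_one when_def)
  moreover have "ordp (Poly_Mapping.map nat (1 :: 'a zpoly)) = abs_ordinal (ord_of_nat 1)"
    by (rule ocoeff_inj) (simp add: lookup_one when_def ocoeff_ord_of_nat)
  ultimately show ?thesis
    by (simp add: z_one_def polyz_def rep_zero del: ord_of_nat.simps(2))
qed

lemma z_dvd_polyz [simp]: "z_dvd (polyz d) (polyz a) \<longleftrightarrow> d dvd a"
  by (simp add: z_dvd_def Bex_Z_inf dvd_def)

text \<open>At the leading exponent only the positive part has a nonzero coefficient, and above it
  both parts vanish; hence the sign of a surinteger is that of its leading coefficient.\<close>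

lemma pos_part_less:
  fixes f :: "'v::set_universe zpoly"
  assumes "0 < lcoeff f"
  shows "ordp (Poly_Mapping.map nat (- f)) < ordp (Poly_Mapping.map nat f)"
proof -
  have f: "f \<noteq> 0"
    using assms by auto
  show ?thesis
    unfolding less_iff_ocoeff[of "ordp (Poly_Mapping.map nat (- f))"]
  proof (intro exI[of _ "lead f"] conjI allI impI)
    show "ocoeff (ordp (Poly_Mapping.map nat (- f))) (lead f) < ocoeff (ordp (Poly_Mapping.map nat f)) (lead f)"
      using assms by (simp add: lcoeff_def)
    fix j assume "lead f < j"
    then have "j \<notin> keys f"
      using lead_ge[of j f] by auto
    then show "ocoeff (ordp (Poly_Mapping.map nat (- f))) j = ocoeff (ordp (Poly_Mapping.map nat f)) j"
      by (simp add: in_keys_iff)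
  qed
qed

lemma lcoeff_uminus [simp]: "lcoeff (- f) = - lcoeff f"
  for f :: "'m::linorder \<Rightarrow>\<^sub>0 int"
  by (simp add: lcoeff_def lead_def)

lemma part_order:
  fixes f :: "'v::set_universe zpoly"
  shows "ordp (Poly_Mapping.map nat (- f)) \<le> ordp (Poly_Mapping.map nat f) \<longleftrightarrow> 0 \<le> lcoeff f"
    and "ordp (Poly_Mapping.map nat f) < ordp (Poly_Mapping.map nat (- f)) \<longleftrightarrow> lcoeff f < 0"
proof -
  consider "0 < lcoeff f" | "lcoeff f < 0" | "f = 0"
    using lcoeff_nonzero[of f] by linarith
  then have "(ordp (Poly_Mapping.map nat (- f)) \<le> ordp (Poly_Mapping.map nat f) \<longleftrightarrow> 0 \<le> lcoeff f) \<and>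
    (ordp (Poly_Mapping.map nat f) < ordp (Poly_Mapping.map nat (- f)) \<longleftrightarrow> lcoeff f < 0)"
    using pos_part_less[of f] pos_part_less[of "- f"] by cases auto
  then show "ordp (Poly_Mapping.map nat (- f)) \<le> ordp (Poly_Mapping.map nat f) \<longleftrightarrow> 0 \<le> lcoeff f"
    and "ordp (Poly_Mapping.map nat f) < ordp (Poly_Mapping.map nat (- f)) \<longleftrightarrow> lcoeff f < 0"
    by auto
qed

lemma polyz_nonneg_iff: "polyz f \<in> Z_nonneg \<longleftrightarrow> 0 \<le> lcoeff f"
  using part_order(1)[of f] by (simp add: Z_nonneg_def) (simp add: polyz_def less_eq_ordinal_def)

lemma polyz_neg_iff: "polyz f \<in> Z_neg \<longleftrightarrow> lcoeff f < 0"
  using part_order(2)[of f] by (simp add: Z_neg_def) (simp add: polyz_def less_ordinal_def)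

lemma lcoeff_eq_0_iff [simp]: "lcoeff f = 0 \<longleftrightarrow> f = 0"
  by (metis lcoeff_nonzero lcoeff_zero)

lemma lcoeff_pos_iff: "0 < lcoeff f \<longleftrightarrow> 0 \<le> lcoeff f \<and> f \<noteq> 0"
  for f :: "'m::linorder \<Rightarrow>\<^sub>0 int"
  using lcoeff_eq_0_iff[of f] by linarith

lemma polyz_pos_iff [simp]: "polyz f \<in> Z_pos \<longleftrightarrow> 0 < lcoeff f"
  by (simp add: Z_pos_def polyz_nonneg_iff z_zero_eq lcoeff_pos_iff)

lemma not_oless_zero: "\<not> oless x (ord_of_nat 0)"
  by (simp add: oless_def)

lemma z_le_zero [simp]: "z_le z_zero (polyz f) \<longleftrightarrow> 0 \<le> lcoeff f"
proof -
  have zero: "z_zero \<in> Z_nonneg" "(z_zero :: 'a) \<notin> Z_neg"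
    by (simp_all add: z_zero_eq polyz_nonneg_iff polyz_neg_iff)
  \<comment> \<open>The critical case is a second coordinate 0: the first coordinate is at most the
    second and therefore 0 as well.\<close>
  have "oless (ord_of_nat 0) (vsnd (polyz f)) \<or> ord_of_nat 0 = vsnd (polyz f) \<and> ole (vfst (polyz f)) (ord_of_nat 0)"
    if "polyz f \<in> Z_nonneg"
    using that Ord_linear[of "ord_of_nat 0" "vsnd (polyz f)"] not_oless_zero[of "vsnd (polyz f)"]
    by (auto simp: Z_nonneg_def oless_def polyz_def)
  then show ?thesis
    using zero by (auto simp: z_le_def z_zero_def simp flip: polyz_nonneg_iff)
qed

lemma z_less_zero [simp]: "z_less z_zero (polyz f) \<longleftrightarrow> 0 < lcoeff f"
  unfolding z_less_def z_le_zero lcoeff_pos_iff by (auto simp: z_zero_eq)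

lemma z_less_zero' [simp]: "z_less (polyz f) z_zero \<longleftrightarrow> lcoeff f < 0"
proof
  assume less: "z_less (polyz f) z_zero"
  show "lcoeff f < 0"
  proof (rule ccontr)
    assume "\<not> lcoeff f < 0"
    then have nn: "polyz f \<in> Z_nonneg" "polyz f \<notin> Z_neg"
      by (simp_all add: polyz_nonneg_iff polyz_neg_iff)
    then have "vsnd (polyz f) = ord_of_nat 0"
      using less not_oless_zero by (auto simp: z_less_def z_le_def z_zero_def)
    moreover have "ole (vfst (polyz f)) (vsnd (polyz f))"
      using nn(1) by (simp add: Z_nonneg_def)
    ultimately have "vfst (polyz f) = ord_of_nat 0"
      using not_oless_zero by (metis ole_def)
    then have "polyz f = z_zero"
      using \<open>vsnd (polyz f) = ord_of_nat 0\<close> by (simp add: polyz_def z_zero_def)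
    then show False
      using less by (simp add: z_less_def)
  qed
next
  assume f: "lcoeff f < 0"
  moreover have "z_zero \<in> Z_nonneg"
    by (simp add: z_zero_eq polyz_nonneg_iff)
  ultimately show "z_less (polyz f) z_zero"
    by (auto simp: z_less_def z_le_def polyz_neg_iff z_zero_eq)
qed

lemma polyz_below_iff:
  assumes "times_number (rep_ordinal L)"
  shows "polyz f \<in> Z_below (rep_ordinal L) \<longleftrightarrow> f \<in> supported (exponents_below L)"
proof -
  have "polyz f \<in> Z_below (rep_ordinal L) \<longleftrightarrow>
      ordp (Poly_Mapping.map nat (- f)) < L \<and> ordp (Poly_Mapping.map nat f) < L"
    by (simp add: Z_below_def) (simp add: polyz_def less_ordinal_def)
  also have "\<dots> \<longleftrightarrow> keys (Poly_Mapping.map nat (- f)) \<union> keys (Poly_Mapping.map nat f) \<subseteq> exponents_below L"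
    by (simp add: less_times_number_iff[OF assms])
  also have "keys (Poly_Mapping.map nat (- f)) \<union> keys (Poly_Mapping.map nat f) = keys f"
    by (auto simp: in_keys_iff)
  finally show ?thesis
    by (simp add: supported_def)
qed

section \<open>Surrationals as fractions\<close>

lemma lcoeff_times: "lcoeff (f * g) = lcoeff f * lcoeff g"
  for f g :: "'m::{linorder,ordered_cancel_comm_monoid_add} \<Rightarrow>\<^sub>0 int"
  by (cases "f = 0 \<or> g = 0") (auto simp: lcoeff_mult)

lemma lcoeff_add_nonneg:
  fixes f g :: "'m::linorder \<Rightarrow>\<^sub>0 int"
  assumes "0 \<le> lcoeff f" "0 \<le> lcoeff g"
  shows "0 \<le> lcoeff (f + g)"
proof -
  \<comment> \<open>By symmetry u may carry the larger leading exponent. There v contributes its own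
    leading coefficient or 0, so the positive coefficient of u cannot be cancelled.\<close>
  have *: "0 \<le> lcoeff (u + v)" if uv: "u \<noteq> 0" "0 \<le> lcoeff u" "0 \<le> lcoeff v" "v = 0 \<or> lead v \<le> lead u"
    for u v :: "'m \<Rightarrow>\<^sub>0 int"
  proof (cases "v = 0")
    case False
    have u: "0 < lookup u (lead u)"
      using uv by (simp add: lcoeff_pos_iff flip: lcoeff_def)
    have v: "0 \<le> lookup v (lead u)"
    proof (cases "lead v = lead u")
      case True
      then show ?thesis
        using uv(3) by (simp add: lcoeff_def)
    next
      case False
      then have "lead u \<notin> keys v"
        using uv(4) \<open>v \<noteq> 0\<close> lead_ge[of "lead u" v] by auto
      then show ?thesis
        by (simp add: in_keys_iff)
    qed
    have pos: "0 < lookup (u + v) (lead u)"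
      using u v by (simp add: lookup_add)
    moreover have "lead (u + v) = lead u"
    proof (rule lead_unique)
      show "lead u \<in> keys (u + v)"
        using pos by (simp add: in_keys_iff)
      show "k \<le> lead u" if "k \<in> keys (u + v)" for k
        using that keys_add[of u v] lead_ge[of k u] lead_ge[of k v] uv(4) False by fastforce
    qed
    ultimately show ?thesis
      by (simp add: lcoeff_def)
  qed (use uv in simp)
  show ?thesis
  proof (cases "f = 0 \<or> g = 0")
    case True
    then show ?thesis using assms by auto
  next
    case False
    then show ?thesis
      using *[of f g] *[of g f] assms by (cases "lead g \<le> lead f") (auto simp: add.commute)
  qed
qed

section \<open>The order of the fraction field\<close>

lemma Fract_pos_denom_cases:
  fixes x :: "'v::set_universe zpoly fract"
  obtains a b where "x = Fract a b" "0 < lcoeff b"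
proof (cases x)
  case (Fract a b)
  show ?thesis
  proof (cases "0 < lcoeff b")
    case False
    then have "0 < lcoeff (- b)"
      using Fract(2) by (simp add: lcoeff_pos_iff)
    moreover have "x = Fract (- a) (- b)"
      using Fract by simp
    ultimately show ?thesis
      using that by blast
  qed (use Fract that in blast)
qed

text \<open>With a positive denominator the sign of the numerator does not depend on the
  representation, as \<open>fnonneg_Fract\<close> confirms.\<close>

definition fnonneg :: "'v::set_universe zpoly fract \<Rightarrow> bool" where
  "fnonneg x \<longleftrightarrow> (\<exists>a b. x = Fract a b \<and> 0 < lcoeff b \<and> 0 \<le> lcoeff a)"

lemma fnonneg_Fract:
  fixes a b :: "'v::set_universe zpoly"
  assumes "0 < lcoeff b"
  shows "fnonneg (Fract a b) \<longleftrightarrow> 0 \<le> lcoeff a"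
proof
  assume "fnonneg (Fract a b)"
  then obtain c d where cd: "Fract a b = Fract c d" "0 < lcoeff d" "0 \<le> lcoeff c"
    unfolding fnonneg_def by blast
  then have "a * d = c * b"
    using assms by (subst (asm) eq_fract) auto
  then have "lcoeff a * lcoeff d = lcoeff c * lcoeff b"
    by (metis lcoeff_times)
  moreover have "0 \<le> lcoeff c * lcoeff b"
    using cd assms by simp
  ultimately show "0 \<le> lcoeff a"
    using cd(2) by (metis not_le zero_le_mult_iff order.asym)
qed (use assms in \<open>auto simp: fnonneg_def\<close>)

lemma fnonneg_add: "fnonneg x \<Longrightarrow> fnonneg y \<Longrightarrow> fnonneg (x + y)"
proof -
  assume "fnonneg x" "fnonneg y"
  then obtain a b c d where *: "x = Fract a b" "0 < lcoeff b" "0 \<le> lcoeff a"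
      "y = Fract c d" "0 < lcoeff d" "0 \<le> lcoeff c"
    unfolding fnonneg_def by blast
  then have "x + y = Fract (a * d + c * b) (b * d)"
    by (metis add_fract lcoeff_zero less_irrefl)
  moreover have "0 < lcoeff (b * d)" "0 \<le> lcoeff (a * d + c * b)"
    using * by (auto simp: lcoeff_times intro!: lcoeff_add_nonneg)
  ultimately show ?thesis
    by (simp add: fnonneg_Fract)
qed

lemma fnonneg_mult: "fnonneg x \<Longrightarrow> fnonneg y \<Longrightarrow> fnonneg (x * y)"
proof -
  assume "fnonneg x" "fnonneg y"
  then obtain a b c d where *: "x = Fract a b" "0 < lcoeff b" "0 \<le> lcoeff a"
      "y = Fract c d" "0 < lcoeff d" "0 \<le> lcoeff c"
    unfolding fnonneg_def by blast
  then have "x * y = Fract (a * c) (b * d)"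
    by simp
  moreover have "0 < lcoeff (b * d)" "0 \<le> lcoeff (a * c)"
    using * by (simp_all add: lcoeff_times)
  ultimately show ?thesis
    by (simp add: fnonneg_Fract)
qed

lemma fnonneg_antisym: "fnonneg x \<Longrightarrow> fnonneg (- x) \<Longrightarrow> x = 0"
proof (cases x rule: Fract_pos_denom_cases)
  case (1 a b)
  assume "fnonneg x" "fnonneg (- x)"
  then have "lcoeff a = 0"
    using 1 by (auto simp: fnonneg_Fract)
  then show ?thesis
    using 1 by (simp add: fract_collapse)
qed

lemma fnonneg_total: "fnonneg x \<or> fnonneg (- x)"
  by (cases x rule: Fract_pos_denom_cases) (auto simp: fnonneg_Fract)

lemma fnonneg_zero [simp]: "fnonneg 0"
  using fnonneg_total[of 0] by simp

section \<open>Reduced pairs and their values in the fraction field\<close>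

definition qpair :: "'v::set_universe zpoly \<Rightarrow> 'v zpoly \<Rightarrow> 'v" where
  "qpair a b = vpair (polyz a) (polyz b)"

lemma vfst_qpair [simp]: "vfst (qpair a b) = polyz a"
  and vsnd_qpair [simp]: "vsnd (qpair a b) = polyz b"
  and qpair_eq_iff [simp]: "qpair a b = qpair c d \<longleftrightarrow> a = c \<and> b = d"
  by (simp_all add: qpair_def)

lemma Z_pos_cases: "x \<in> Z_pos \<Longrightarrow> \<exists>f. x = polyz f \<and> 0 < lcoeff f"
proof -
  assume x: "x \<in> Z_pos"
  then have "x \<in> Z_inf"
    by (auto simp: Z_pos_def Z_nonneg_def)
  then obtain f where "x = polyz f"
    by (auto simp: Z_inf_eq)
  with x show ?thesis
    using polyz_pos_iff by blast
qed

lemma Q_inf_iff: "qpair a b \<in> Q_inf \<longleftrightarrow> 0 < lcoeff b \<and> ord.coprime_pair a b"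
proof -
  have "(d dvd 1) \<longleftrightarrow> d = 1 \<or> d = - 1" for d :: "'a zpoly"
    using ord.unit_cases[of d] by auto
  then show ?thesis
    by (auto simp: Q_inf_def qpair_def Ball_Z_inf z_one_eq ord.coprime_pair_def)
qed

lemma Q_inf_cases:
  assumes "q \<in> Q_inf"
  obtains a b where "q = qpair a b" "0 < lcoeff b" "ord.coprime_pair a b"
proof -
  obtain x y where "q = vpair x y" "x \<in> Z_inf" "y \<in> Z_pos"
    using assms unfolding Q_inf_def by blast
  then obtain a b where "q = qpair a b"
    using Z_pos_cases[of y] by (auto simp: Z_inf_eq qpair_def)
  then show ?thesis
    using that assms Q_inf_iff by blast
qed

text \<open>Meaningful for pairs of surintegers, the only elements in the range of
  \<open>qpair\<close>. Laws for reduced pairs become identities between fractions.\<close>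

definition qval :: "'v::set_universe \<Rightarrow> 'v zpoly fract" where
  "qval q = Fract (inv polyz (vfst q)) (inv polyz (vsnd q))"

lemma qval_qpair [simp]: "qval (qpair a b) = Fract a b"
proof -
  have "inj (polyz :: 'a zpoly \<Rightarrow> 'a)"
    by (simp add: inj_def)
  then show ?thesis
    by (simp add: qval_def)
qed

text \<open>Equal reduced fractions differ by a unit, which is 1 or - 1, and positivity of both
  denominators excludes - 1.\<close>

lemma qval_inj:
  assumes "p \<in> Q_inf" "q \<in> Q_inf" "qval p = qval q"
  shows "p = q"
proof -
  obtain a b where p: "p = qpair a b" "0 < lcoeff b" "ord.coprime_pair a b"
    using assms(1) by (rule Q_inf_cases)
  obtain c d where q: "q = qpair c d" "0 < lcoeff d" "ord.coprime_pair c d"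
    using assms(2) by (rule Q_inf_cases)
  have nz: "b \<noteq> 0" "d \<noteq> 0"
    using p(2) q(2) by auto
  have "Fract a b = Fract c d"
    using assms(3) p(1) q(1) by simp
  then have "a * d = c * b"
    using nz by (simp add: eq_fract)
  then obtain u where u: "u dvd 1" "c = u * a" "d = u * b"
    using ord.coprime_pair_unique[OF p(3) q(3) nz] by blast
  have "u \<noteq> - 1"
    using u(3) p(2) q(2) by auto
  then have "u = 1"
    using ord.unit_cases[OF u(1)] by blast
  then show ?thesis
    using p(1) q(1) u by simp
qed

lemma frac_equiv_qpair:
  "frac_equiv (qpair x y) (qpair a b) \<longleftrightarrow> 0 < lcoeff y \<and> 0 < lcoeff b \<and> Fract x y = Fract a b"
proof (cases "0 < lcoeff y \<and> 0 < lcoeff b")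
  case True
  then have nz: "y \<noteq> 0" "b \<noteq> 0"
    by auto
  have "frac_equiv (qpair x y) (qpair a b) \<longleftrightarrow>
      (\<exists>u v. u \<noteq> 0 \<and> v \<noteq> 0 \<and> u * x = v * a \<and> u * y = v * b)"
    using True by (simp add: frac_equiv_def Bex_Z_inf z_zero_eq) (simp add: qpair_def)
  also have "\<dots> \<longleftrightarrow> x * b = a * y"
  proof
    assume "\<exists>u v. u \<noteq> 0 \<and> v \<noteq> 0 \<and> u * x = v * a \<and> u * y = v * b"
    then obtain u v where uv: "u \<noteq> 0" "v \<noteq> 0" "u * x = v * a" "u * y = v * b"
      by blast
    have "(u * v) * (x * b) = (u * x) * (v * b)"
      by (simp only: ac_simps)
    also have "\<dots> = (u * v) * (a * y)"
      unfolding uv(3) unfolding uv(4)[symmetric] by (simp only: ac_simps)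
    finally show "x * b = a * y"
      using uv(1,2) by simp
  next
    assume "x * b = a * y"
    then show "\<exists>u v. u \<noteq> 0 \<and> v \<noteq> 0 \<and> u * x = v * a \<and> u * y = v * b"
      using nz by (intro exI[of _ b] exI[of _ y]) (simp add: mult.commute)
  qed
  finally show ?thesis
    using True nz by (simp add: eq_fract)
next
  case False
  then show ?thesis
    by (auto simp: frac_equiv_def qpair_def)
qed

text \<open>Changing the signs of a0, b0 and d0 together makes the denominator positive without
  affecting x and y. The two divisibilities are recorded because they keep the reduced pair inside a
  subring closed under divisors.\<close>

lemma reduced_polyz:
  assumes "0 < lcoeff y"
  obtains a b where "reduced (polyz x) (polyz y) = qpair a b" "qpair a b \<in> Q_inf"
    "Fract a b = Fract x y" "a dvd x" "b dvd y"
proof -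
  have y: "y \<noteq> 0"
    using assms by auto
  obtain a0 b0 d0 where ab0: "x = d0 * a0" "y = d0 * b0" "ord.coprime_pair a0 b0"
    using ord.coprime_pair_exists[OF y] by blast
  have "\<exists>a b d. x = d * a \<and> y = d * b \<and> ord.coprime_pair a b \<and> 0 < lcoeff b"
  proof (cases "0 < lcoeff b0")
    case True
    then show ?thesis using ab0 by blast
  next
    case False
    then have "0 < lcoeff (- b0)"
      using y ab0(2) by (auto simp: lcoeff_pos_iff)
    moreover have "ord.coprime_pair (- a0) (- b0)"
      using ab0(3) by (simp add: ord.coprime_pair_def)
    ultimately show ?thesis
      using ab0 by (intro exI[of _ "- a0"] exI[of _ "- b0"] exI[of _ "- d0"]) simp
  qed
  then obtain a b d where ab: "x = d * a" "y = d * b" "ord.coprime_pair a b" "0 < lcoeff b"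
    by blast
  have "d \<noteq> 0"
    using y ab(2) by auto
  then have eq: "Fract a b = Fract x y"
    by (simp add: ab mult_fract_cancel)
  have Q: "qpair a b \<in> Q_inf"
    using ab by (simp add: Q_inf_iff)
  have "reduced (polyz x) (polyz y) = qpair a b"
    unfolding reduced_def
  proof (rule the_equality)
    show "qpair a b \<in> Q_inf \<and> frac_equiv (vpair (polyz x) (polyz y)) (qpair a b)"
      using Q assms ab(4) eq by (simp add: frac_equiv_qpair flip: qpair_def)
    fix q assume q: "q \<in> Q_inf \<and> frac_equiv (vpair (polyz x) (polyz y)) q"
    then obtain a' b' where q': "q = qpair a' b'"
      using Q_inf_cases by blast
    then have "qval q = qval (qpair a b)"
      using q eq by (simp add: frac_equiv_qpair flip: qpair_def)
    then show "q = qpair a b"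
      using qval_inj q Q by blast
  qed
  with Q eq ab show ?thesis
    using that by simp
qed

context
  fixes L :: "'v::set_universe ordinal"
  assumes L: "times_number (rep_ordinal L)"
begin

section \<open>Operations on reduced pairs below a multiplicatively closed ordinal\<close>

definition below_ring :: "'v zpoly set" where
  "below_ring = supported (exponents_below L)"

lemma below_ring_one: "1 \<in> below_ring"
  unfolding below_ring_def using zero_exponents_below[OF L] by (rule supported_one)

lemma below_ring_zero [simp]: "0 \<in> below_ring"
  and below_ring_add: "f \<in> below_ring \<Longrightarrow> g \<in> below_ring \<Longrightarrow> f + g \<in> below_ring"
  and below_ring_uminus [simp]: "- f \<in> below_ring \<longleftrightarrow> f \<in> below_ring"
  by (simp_all add: below_ring_def supported_add)

lemma below_ring_mult: "f \<in> below_ring \<Longrightarrow> g \<in> below_ring \<Longrightarrow> f * g \<in> below_ring"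
  unfolding below_ring_def by (erule supported_mult) (auto intro: add_exponents_below[OF L])

text \<open>Leading exponents add and none is below 0, so \<open>lead a\<close> is at most
  \<open>lead x\<close>. All exponents of a are at most \<open>lead a\<close>, and the admissible
  exponents are downward closed.\<close>

lemma below_ring_dvd:
  assumes "a dvd x" "x \<in> below_ring" "x \<noteq> 0"
  shows "a \<in> below_ring"
proof -
  obtain c where c: "x = a * c"
    using assms(1) by blast
  then have nz: "a \<noteq> 0" "c \<noteq> 0"
    using assms(3) by auto
  have "lead x \<in> exponents_below L"
    using assms(2) lead_in_keys[OF assms(3)] by (auto simp: below_ring_def supported_def)
  moreover have "lead a \<le> lead x"
    using ord.zero_le[of "lead c"] add_left_mono[of 0 "lead c" "lead a"] nz by (simp add: c lead_mult)
  ultimately have "lead a \<in> exponents_below L"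
    by (rule exponents_below_down)
  then show ?thesis
    using lead_ge[of _ a] exponents_below_down by (auto simp: below_ring_def supported_def)
qed

lemma Q_below_iff: "qpair a b \<in> Q_below (rep_ordinal L) \<longleftrightarrow> qpair a b \<in> Q_inf \<and> a \<in> below_ring \<and> b \<in> below_ring"
  using polyz_below_iff[OF L] by (auto simp: Q_below_def below_ring_def qpair_def)

lemma Q_below_Q_inf: "q \<in> Q_below (rep_ordinal L) \<Longrightarrow> q \<in> Q_inf"
  by (auto simp: Q_below_def)

lemma Q_below_cases:
  assumes "q \<in> Q_below (rep_ordinal L)"
  obtains a b where "q = qpair a b" "0 < lcoeff b" "ord.coprime_pair a b" "a \<in> below_ring" "b \<in> below_ring"
proof -
  obtain a b where q: "q = qpair a b" "0 < lcoeff b" "ord.coprime_pair a b"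
    using Q_below_Q_inf[OF assms] by (rule Q_inf_cases)
  then show ?thesis
    using that assms Q_below_iff[of a b] by blast
qed

lemma qval_inj_below:
  "p \<in> Q_below (rep_ordinal L) \<Longrightarrow> q \<in> Q_below (rep_ordinal L) \<Longrightarrow> qval p = qval q \<longleftrightarrow> p = q"
  using qval_inj Q_below_Q_inf by blast

lemma reduced_below:
  assumes "0 < lcoeff y" "x \<in> below_ring" "y \<in> below_ring"
  shows "reduced (polyz x) (polyz y) \<in> Q_below (rep_ordinal L) \<and> qval (reduced (polyz x) (polyz y)) = Fract x y"
proof -
  obtain a b where ab: "reduced (polyz x) (polyz y) = qpair a b" "qpair a b \<in> Q_inf"
    "Fract a b = Fract x y" "a dvd x" "b dvd y"
    using assms(1) by (rule reduced_polyz)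
  have b0: "0 < lcoeff b"
    using ab(2) by (simp add: Q_inf_iff)
  have y0: "y \<noteq> 0"
    using assms(1) by auto
  then have "b \<in> below_ring"
    using below_ring_dvd[OF ab(5) assms(3)] by blast
  moreover have "a \<in> below_ring"
  \<comment> \<open>Everything divides 0, so for x = 0 the divisibility says nothing; equality of
    the fractions gives a = 0 instead.\<close>
  proof (cases "x = 0")
    case True
    then have "a * y = 0"
      using ab(3) b0 assms(1) eq_fract(1)[of b y a x] by fastforce
    then show ?thesis
      using assms(1) by auto
  next
    case False
    then show ?thesis
      using below_ring_dvd[OF ab(4) assms(2)] by blast
  qed
  ultimately show ?thesis
    using ab by (simp add: Q_below_iff)
qed

lemma
  assumes "p \<in> Q_below (rep_ordinal L)" "q \<in> Q_below (rep_ordinal L)"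
  shows q_add_below: "q_add p q \<in> Q_below (rep_ordinal L)"
    and qval_add: "qval (q_add p q) = qval p + qval q"
    and q_mul_below: "q_mul p q \<in> Q_below (rep_ordinal L)"
    and qval_mul: "qval (q_mul p q) = qval p * qval q"
proof -
  obtain a b where p: "p = qpair a b" "0 < lcoeff b" "a \<in> below_ring" "b \<in> below_ring"
    using assms(1) by (rule Q_below_cases)
  obtain c d where q: "q = qpair c d" "0 < lcoeff d" "c \<in> below_ring" "d \<in> below_ring"
    using assms(2) by (rule Q_below_cases)
  have nz: "b \<noteq> 0" "d \<noteq> 0"
    using p(2) q(2) by auto
  have bd: "0 < lcoeff (b * d)" "b * d \<in> below_ring"
    using p q by (simp_all add: lcoeff_times below_ring_mult)
  have "a * d + b * c \<in> below_ring" "a * c \<in> below_ring"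
    using p q by (auto intro: below_ring_add below_ring_mult)
  then show "q_add p q \<in> Q_below (rep_ordinal L)" "qval (q_add p q) = qval p + qval q"
      "q_mul p q \<in> Q_below (rep_ordinal L)" "qval (q_mul p q) = qval p * qval q"
    using reduced_below[OF bd(1) _ bd(2)] nz by (simp_all add: p(1) q(1) q_add_def q_mul_def mult.commute)
qed

lemma
  assumes "p \<in> Q_below (rep_ordinal L)"
  shows q_neg_below: "q_neg p \<in> Q_below (rep_ordinal L)"
    and qval_neg: "qval (q_neg p) = - qval p"
proof -
  obtain a b where p: "p = qpair a b" "0 < lcoeff b" "ord.coprime_pair a b" "a \<in> below_ring" "b \<in> below_ring"
    using assms by (rule Q_below_cases)
  have "q_neg p = qpair (- a) b"
    by (simp add: q_neg_def p(1)) (simp add: qpair_def)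
  moreover have "ord.coprime_pair (- a) b"
    using p(3) by (simp add: ord.coprime_pair_def)
  ultimately show "q_neg p \<in> Q_below (rep_ordinal L)" "qval (q_neg p) = - qval p"
    using p by (simp_all add: Q_below_iff Q_inf_iff)
qed

lemma q_zero_below: "q_zero \<in> Q_below (rep_ordinal L)"
  and q_one_below: "q_one \<in> Q_below (rep_ordinal L)"
  and qval_zero: "qval q_zero = (0 :: 'v zpoly fract)"
  and qval_one: "qval q_one = (1 :: 'v zpoly fract)"
proof -
  have "0 < lcoeff (1 :: 'v zpoly)"
    by (simp add: lcoeff_def lead_def)
  moreover have "ord.coprime_pair a 1" for a :: "'v zpoly"
    by (simp add: ord.coprime_pair_def)
  moreover have eq: "q_zero = qpair (0 :: 'v zpoly) 1" "q_one = qpair (1 :: 'v zpoly) 1"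
    by (simp_all add: q_zero_def q_one_def z_zero_eq z_one_eq qpair_def)
  ultimately show "q_zero \<in> Q_below (rep_ordinal L)" "q_one \<in> Q_below (rep_ordinal L)"
      "qval q_zero = (0 :: 'v zpoly fract)" "qval q_one = (1 :: 'v zpoly fract)"
    unfolding eq using below_ring_one by (simp_all add: Q_below_iff Q_inf_iff Zero_fract_def One_fract_def)
qed

lemma
  assumes "p \<in> Q_below (rep_ordinal L)"
  shows q_inv_below: "q_inv p \<in> Q_below (rep_ordinal L)"
    and qval_inv: "qval (q_inv p) = inverse (qval p)"
proof -
  obtain a b where p: "p = qpair a b" "0 < lcoeff b" "ord.coprime_pair a b" "a \<in> below_ring" "b \<in> below_ring"
    using assms by (rule Q_below_cases)
  have cop: "ord.coprime_pair b a" "ord.coprime_pair (- b) (- a)"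
    using p(3) by (auto simp: ord.coprime_pair_def)
  consider "0 < lcoeff a" | "lcoeff a < 0" | "a = 0"
    using lcoeff_eq_0_iff[of a] by linarith
  then have "q_inv p \<in> Q_below (rep_ordinal L) \<and> qval (q_inv p) = inverse (qval p)"
  proof cases
    case 1
    then have "q_inv p = qpair b a"
      by (simp add: q_inv_def p(1)) (simp add: qpair_def)
    then show ?thesis
      using p cop 1 by (simp add: Q_below_iff Q_inf_iff)
  next
    case 2
    then have "q_inv p = qpair (- b) (- a)"
      by (simp add: q_inv_def p(1)) (simp add: qpair_def)
    then show ?thesis
      using p cop 2 by (simp add: Q_below_iff Q_inf_iff)
  next
    \<comment> \<open>The convention that 0 is its own inverse coincides with
      \<open>inverse 0 = 0\<close> in the fraction field.\<close>
    case 3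
    then have "q_inv p = q_zero"
      by (simp add: q_inv_def p(1) q_zero_def)
    moreover have "inverse (qval p) = 0"
      using 3 by (simp add: p(1) fract_collapse)
    ultimately show ?thesis
      using q_zero_below qval_zero by simp
  qed
  then show "q_inv p \<in> Q_below (rep_ordinal L)" "qval (q_inv p) = inverse (qval p)"
    by auto
qed

lemma q_le_iff:
  assumes "p \<in> Q_below (rep_ordinal L)" "q \<in> Q_below (rep_ordinal L)"
  shows "q_le p q \<longleftrightarrow> fnonneg (qval q - qval p)"
proof -
  let ?d = "q_add q (q_neg p)"
  have d: "?d \<in> Q_below (rep_ordinal L)" "qval ?d = qval q - qval p"
    using assms by (simp_all add: q_add_below q_neg_below qval_add qval_neg)
  obtain a b where ab: "?d = qpair a b" "0 < lcoeff b"
    using d(1) by (rule Q_below_cases)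
  then have "qval q - qval p = Fract a b"
    using d(2) by simp
  then show ?thesis
    using ab by (simp add: q_le_def fnonneg_Fract)
qed

end

section \<open>The ordered fields below a multiplicatively closed ordinal\<close>

lemma vpair_in_restrict_rel [simp]: "vpair x y \<in> restrict_rel R A \<longleftrightarrow> x \<in> A \<and> y \<in> A \<and> R x y"
  by (auto simp: restrict_rel_def)

lemma is_set_restrict:
  assumes "is_set A"
  shows "is_set (restrict_rel R A)" "is_set (restrict_unary f A)" "is_set (restrict_binary g A)"
proof -
  show "is_set (restrict_rel R A)"
    by (rule is_set_subset[OF is_set_vtimes[OF assms assms]]) (auto simp: restrict_rel_def)
  have "restrict_unary f A = (\<lambda>x. vpair x (f x)) ` A"
    by (auto simp: restrict_unary_def)
  then show "is_set (restrict_unary f A)"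
    using assms by (simp add: is_set_image)
  have "restrict_binary g A = (\<lambda>p. vpair p (g (vfst p) (vsnd p))) ` vtimes A A"
    by (force simp: restrict_binary_def vtimes_def)
  then show "is_set (restrict_binary g A)"
    using assms by (simp add: is_set_image is_set_vtimes)
qed

lemma is_function_restrict_unary: "(\<And>x. x \<in> A \<Longrightarrow> f x \<in> A) \<Longrightarrow> is_function (restrict_unary f A) A A"
  by (auto simp: is_function_def restrict_unary_def)

lemma is_function_restrict_binary:
  "(\<And>x y. x \<in> A \<Longrightarrow> y \<in> A \<Longrightarrow> f x y \<in> A) \<Longrightarrow> is_function (restrict_binary f A) (vtimes A A) A"
  by (auto simp: is_function_def restrict_binary_def vtimes_def)

lemma vapp_restrict_unary: "is_set A \<Longrightarrow> x \<in> A \<Longrightarrow> vapp (vset (restrict_unary f A)) x = f x"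
  by (simp add: vapp_def elts_vset is_set_restrict) (simp add: restrict_unary_def)

lemma vapp_restrict_binary:
  "is_set A \<Longrightarrow> x \<in> A \<Longrightarrow> y \<in> A \<Longrightarrow> vapp (vset (restrict_binary f A)) (vpair x y) = f x y"
  by (simp add: vapp_def elts_vset is_set_restrict) (simp add: restrict_binary_def)

lemma is_set_Q_below: "is_set (Q_below k)"
proof -
  have Z: "is_set (Z_below k)"
    by (rule is_set_subset[OF is_set_vtimes[OF is_set_elts is_set_elts, of k k]])
      (auto simp: Z_below_def Z_inf_def oless_def)
  show ?thesis
    by (rule is_set_subset[OF is_set_vtimes[OF Z Z]]) (auto simp: Q_below_def)
qed

context
  fixes L :: "'v::set_universe ordinal"
  assumes L: "times_number (rep_ordinal L)"
begin

abbreviation "QL \<equiv> Q_below (rep_ordinal L)"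

lemma total_ordering_below: "total_ordering (le_below (rep_ordinal L)) QL"
  unfolding total_ordering_def
proof
  let ?r = "{(x, y). vpair x y \<in> le_below (rep_ordinal L)}"
  show "le_below (rep_ordinal L) \<subseteq> vtimes QL QL"
    by (auto simp: le_below_def restrict_rel_def)
  have r: "(p, q) \<in> ?r \<longleftrightarrow> p \<in> QL \<and> q \<in> QL \<and> fnonneg (qval q - qval p)" for p q
    by (auto simp: le_below_def q_le_iff[OF L])
  show "linear_order_on QL ?r"
    unfolding linear_order_on_def partial_order_on_def preorder_on_def
  proof (intro conjI)
    show "?r \<subseteq> QL \<times> QL"
      by (auto simp: le_below_def)
    show "refl_on QL ?r"
      unfolding refl_on_def r by simp
    show "trans ?r"
    proof (rule transI)
      fix x y z assume "(x, y) \<in> ?r" "(y, z) \<in> ?r"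
      then show "(x, z) \<in> ?r"
        unfolding r using fnonneg_add[of "qval y - qval x" "qval z - qval y"] by simp
    qed
    show "antisym ?r"
    proof (rule antisymI)
      fix x y assume "(x, y) \<in> ?r" "(y, x) \<in> ?r"
      then have xy: "x \<in> QL" "y \<in> QL" "fnonneg (qval y - qval x)" "fnonneg (qval x - qval y)"
        unfolding r by simp_all
      then have "qval y - qval x = 0"
        by (intro fnonneg_antisym) simp_all
      then show "x = y"
        using qval_inj_below[OF L xy(1,2)] by simp
    qed
    show "total_on QL ?r"
    proof -
      have "fnonneg (qval y - qval x) \<or> fnonneg (qval x - qval y)" for x y :: 'v
        using fnonneg_total[of "qval y - qval x"] by simp
      then show ?thesis
        unfolding total_on_def r by blast
    qed
  qed
qed

lemma is_function_below:
  shows "is_function (add_below (rep_ordinal L)) (vtimes QL QL) QL"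
    and "is_function (mul_below (rep_ordinal L)) (vtimes QL QL) QL"
    and "is_function (neg_below (rep_ordinal L)) QL QL"
    and "is_function (inv_below (rep_ordinal L)) QL QL"
  unfolding add_below_def mul_below_def neg_below_def inv_below_def
  by (intro is_function_restrict_binary is_function_restrict_unary q_add_below[OF L] q_mul_below[OF L]
      q_neg_below[OF L] q_inv_below[OF L]; assumption)+

lemma elts_below:
  "elts (vset QL) = QL"
  "elts (vset (le_below (rep_ordinal L))) = le_below (rep_ordinal L)"
  "elts (vset (add_below (rep_ordinal L))) = add_below (rep_ordinal L)"
  "elts (vset (mul_below (rep_ordinal L))) = mul_below (rep_ordinal L)"
  "elts (vset (neg_below (rep_ordinal L))) = neg_below (rep_ordinal L)"
  "elts (vset (inv_below (rep_ordinal L))) = inv_below (rep_ordinal L)"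
  unfolding le_below_def add_below_def mul_below_def neg_below_def inv_below_def
  by (simp_all add: elts_vset is_set_restrict is_set_Q_below)

lemma vapp_below:
  "p \<in> QL \<Longrightarrow> q \<in> QL \<Longrightarrow> vapp (vset (add_below (rep_ordinal L))) (vpair p q) = q_add p q"
  "p \<in> QL \<Longrightarrow> q \<in> QL \<Longrightarrow> vapp (vset (mul_below (rep_ordinal L))) (vpair p q) = q_mul p q"
  "p \<in> QL \<Longrightarrow> vapp (vset (neg_below (rep_ordinal L))) p = q_neg p"
  unfolding add_below_def mul_below_def neg_below_def
  by (simp_all add: vapp_restrict_binary vapp_restrict_unary is_set_Q_below)

lemma less_below_iff:
  assumes "p \<in> QL" "q \<in> QL"
  shows "vpair p q \<in> le_below (rep_ordinal L) \<and> p \<noteq> q \<longleftrightarrow>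
    fnonneg (qval q - qval p) \<and> qval q - qval p \<noteq> 0"
  using assms qval_inj_below[OF L, of p q] by (auto simp: le_below_def q_le_iff[OF L])

lemma ordered_field_below: "ordered_field (Q_structure (rep_ordinal L))"
proof -
  note closed = q_add_below[OF L] q_mul_below[OF L] q_neg_below[OF L] q_inv_below[OF L]
    q_zero_below[OF L] q_one_below[OF L]
  note val = qval_add[OF L] qval_mul[OF L] qval_neg[OF L] qval_inv[OF L] qval_zero[OF L] qval_one[OF L]
  \<comment> \<open>Read from right to left, injectivity turns each law on the carrier into an
    identity of fractions.\<close>
  note eq = qval_inj_below[OF L, symmetric]
  \<comment> \<open>The sum is nonzero because y = - x would make x and - x both nonnegative, and
    antisymmetry would give x = 0.\<close>
  have less_add: "fnonneg (x + y) \<and> x + y \<noteq> 0"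
    if "fnonneg x \<and> x \<noteq> 0" "fnonneg y \<and> y \<noteq> 0" for x y :: "'v zpoly fract"
    using that fnonneg_add[of x y] fnonneg_antisym[of x] by (auto simp: add_eq_0_iff)
  have less_mult: "fnonneg (x * y) \<and> x * y \<noteq> 0"
    if "fnonneg x \<and> x \<noteq> 0" "fnonneg y \<and> y \<noteq> 0" for x y :: "'v zpoly fract"
    using that fnonneg_mult[of x y] by auto
  let ?less = "\<lambda>p q. vpair p q \<in> le_below (rep_ordinal L) \<and> p \<noteq> q"
  have add_less: "?less (q_add a c) (q_add b d)"
    if "a \<in> QL" "b \<in> QL" "c \<in> QL" "d \<in> QL" "?less a b \<and> ?less c d" for a b c d
  proof -
    have "fnonneg (qval b - qval a) \<and> qval b - qval a \<noteq> 0" "fnonneg (qval d - qval c) \<and> qval d - qval c \<noteq> 0"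
      using that(5) unfolding less_below_iff[OF that(1,2)] less_below_iff[OF that(3,4)] by blast+
    moreover have "qval b + qval d - (qval a + qval c) = (qval b - qval a) + (qval d - qval c)"
      by simp
    ultimately have "fnonneg (qval b + qval d - (qval a + qval c)) \<and> qval b + qval d - (qval a + qval c) \<noteq> 0"
      using less_add by metis
    then show ?thesis
      using that(1-4) by (simp only: less_below_iff closed val simp_thms)
  qed
  have mult_less: "?less q_zero (q_mul a b)"
    if "a \<in> QL" "b \<in> QL" "?less q_zero a \<and> ?less q_zero b" for a b
  proof -
    have "fnonneg (qval a) \<and> qval a \<noteq> 0" "fnonneg (qval b) \<and> qval b \<noteq> 0"
      using that by (simp_all only: less_below_iff closed val diff_zero simp_thms)
    from less_mult[OF this] show ?thesis
      using that(1,2) by (simp only: less_below_iff closed val diff_zero simp_thms)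
  qed
  have inverse: "\<exists>b\<in>QL. vapp (vset (mul_below (rep_ordinal L))) (vpair a b) = q_one"
    if "a \<in> QL" "a \<noteq> q_zero" for a
    using that by (intro bexI[of _ "q_inv a"]) (simp_all add: vapp_below eq closed val)
  have ring:
    "a \<in> QL \<Longrightarrow> b \<in> QL \<Longrightarrow> c \<in> QL \<Longrightarrow> q_add (q_add a b) c = q_add a (q_add b c)"
    "a \<in> QL \<Longrightarrow> b \<in> QL \<Longrightarrow> q_add a b = q_add b a"
    "a \<in> QL \<Longrightarrow> b \<in> QL \<Longrightarrow> c \<in> QL \<Longrightarrow> q_mul (q_mul a b) c = q_mul a (q_mul b c)"
    "a \<in> QL \<Longrightarrow> b \<in> QL \<Longrightarrow> q_mul a b = q_mul b a"
    "a \<in> QL \<Longrightarrow> q_add a q_zero = a"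
    "a \<in> QL \<Longrightarrow> q_add a (q_neg a) = q_zero"
    "a \<in> QL \<Longrightarrow> q_mul a q_one = a"
    "a \<in> QL \<Longrightarrow> b \<in> QL \<Longrightarrow> c \<in> QL \<Longrightarrow> q_mul a (q_add b c) = q_add (q_mul a b) (q_mul a c)"
    for a b c
    by (simp_all add: eq closed val algebra_simps)
  show ?thesis
    unfolding ordered_field_def Q_structure_def
    apply (intro exI conjI)
     apply (rule refl)
    unfolding Let_def elts_below
    apply (intro conjI ballI impI[where P = "_ \<noteq> _"])
                       apply (rule total_ordering_below is_function_below closed(5,6))+
              apply (simp_all only: vapp_below closed)
    by ((rule ring inverse impI[OF add_less] impI[OF mult_less], assumption+)+)
qed

text \<open>The ordinal a is the positive part of the numerator of the fraction a / 1. It is read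
  back by projections that depend on neither a nor L, which suits an application of
  replacement.\<close>

lemma ordinal_in_structure:
  assumes "a < L"
  shows "\<exists>q\<in>elts (vfst (Q_structure (rep_ordinal L))). rep_ordinal a = vsnd (vfst q)"
proof -
  define f :: "'v zpoly" where "f = Poly_Mapping.map int (opoly a)"
  have f: "lookup f i = int (ocoeff a i)" for i
    by (simp add: f_def Poly_Mapping.map.rep_eq when_def)
  have "keys f = keys (opoly a)"
    by (auto simp: in_keys_iff f)
  then have "f \<in> below_ring L"
    using assms less_times_number_iff[OF L] by (simp add: below_ring_def[OF L] supported_def)
  moreover have "0 < lcoeff (1 :: 'v zpoly)"
    by (simp add: lcoeff_def lead_def)
  ultimately have "qpair f 1 \<in> QL"
    using below_ring_one[OF L] by (simp add: Q_below_iff[OF L] Q_inf_iff ord.coprime_pair_def)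
  moreover have "ordp (Poly_Mapping.map nat f) = a"
    by (rule ocoeff_inj) (simp add: f)
  then have "vsnd (polyz f) = rep_ordinal a"
    by (simp add: polyz_def)
  ultimately show ?thesis
    by (intro bexI[of _ "qpair f 1"]) (simp_all add: Q_structure_def structure_tuple_def elts_below)
qed

end

text \<open>The Burali-Forti argument: a set of all ordinals would be an ordinal and thus an element
  of itself.\<close>

lemma not_is_set_Ord: "\<not> is_set {x :: 'v::set_universe. Ord x}"
proof
  assume "is_set {x :: 'v. Ord x}"
  then obtain w :: 'v where w: "elts w = {x. Ord x}"
    unfolding is_set_def by blast
  have "Ord w"
    by (rule OrdI) (auto simp: w intro: Ord_elem)
  then show False
    using w elem_irrefl[of w] by blast
qed

lemma not_is_set_structures: "\<not> is_set {Q_structure k | k :: 'v::set_universe. times_number k}"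
proof
  let ?Y = "{Q_structure k | k :: 'v. times_number k}"
  assume "is_set ?Y"
  \<comment> \<open>The first component of a structure is its carrier; the union of all carriers is
    projected to the positive parts of the numerators.\<close>
  then have "is_set ((\<lambda>q. vsnd (vfst q)) ` (\<Union>s\<in>?Y. elts (vfst s)))" (is "is_set ?V")
    by (intro is_set_image is_set_UN) auto
  moreover have "{x. Ord x} \<subseteq> ?V"
  proof
    fix x :: 'v assume "x \<in> {x. Ord x}"
    then have x: "Ord x" by simp
    then obtain k where k: "times_number k" "oless x k"
      using times_number_unbounded by blast
    then have Ok: "Ord k"
      by (simp add: times_number_def)
    have "\<exists>q\<in>elts (vfst (Q_structure (rep_ordinal (abs_ordinal k)))). rep_ordinal (abs_ordinal x) = vsnd (vfst q)"
      using k x Ok by (intro ordinal_in_structure) (simp_all add: less_ordinal_def)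
    then have "\<exists>q\<in>elts (vfst (Q_structure k)). x = vsnd (vfst q)"
      using x Ok by simp
    then show "x \<in> ?V"
      using k(1) by blast
  qed
  ultimately have "is_set {x :: 'v. Ord x}"
    by (rule is_set_subset)
  then show False
    using not_is_set_Ord by blast
qed

theorem theorem5:
  fixes lam :: "'v::set_universe"
  assumes "times_number lam"
  shows "is_set (Q_below lam)
    \<and> total_ordering (le_below lam) (Q_below lam)
    \<and> is_function (add_below lam) (vtimes (Q_below lam) (Q_below lam)) (Q_below lam)
    \<and> is_function (mul_below lam) (vtimes (Q_below lam) (Q_below lam)) (Q_below lam)
    \<and> is_function (neg_below lam) (Q_below lam) (Q_below lam)
    \<and> is_function (inv_below lam) (Q_below lam) (Q_below lam)
    \<and> ordered_field (Q_structure lam)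
    \<and> \<not> is_set {Q_structure \<kappa> | \<kappa> :: 'v. times_number \<kappa>}"
proof -
  have "Ord lam"
    using assms by (simp add: times_number_def)
  then have lam: "rep_ordinal (abs_ordinal lam) = lam"
    by simp
  then have "times_number (rep_ordinal (abs_ordinal lam))"
    using assms by simp
  from total_ordering_below[OF this] is_function_below[OF this] ordered_field_below[OF this]
  show ?thesis
    unfolding lam using is_set_Q_below not_is_set_structures by blast
qed

end
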